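(* Let $\eta_+\approx 2.4675$ be the positive root of $X^3-X^2-2X-4$. Let $f\colon\mathbb{R}_+\to\mathbb{R}_+$ be a function satisfying $$f(2R)\le f(R)^2\le f(\eta_+R)\quad\text{for all $R$ large enough.}$$ Then there exists a finitely generated group whose growth function $v$ satisfies $v\sim f$.
   Context: The growth function of a group $G$ generated as a semigroup by a finite set $S$ is $v(R)=\#\{g\in G\mid g=s_1\cdots s_\ell,\ \ell\le R,\ s_i\in S\}$. For functions $v,v'\colon\mathbb{R}_+\to\mathbb{R}_+$, write $v\sim v'$ if there is a constant $C>0$ such that $v(R)\le v'(CR)$ and $v'(R)\le v(CR)$ for all $R$ large enough. The $\sim$-class of the growth function of a finitely generated group does not depend on the choice of the finite generating set.
   Formalization: The function f is also assumed to be positive for all large R and nondecreasing up to rescaling of the argument (for some C>0, f(R) ≤ f(CS) for all large R and all S ≥ R); both are necessary for v∼f, and the claim fails for arbitrary f. *)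

theory Defs
  imports "HOL-Algebra.Group" Complex_Main
begin

text \<open>The empty word is allowed in \<open>growth\<close> (so the ball always contains the identity), while
  generation as a semigroup uses nonempty words.\<close>

definition word_prod :: "('a, 'b) monoid_scheme \<Rightarrow> 'a list \<Rightarrow> 'a" where
  "word_prod G w = foldr (\<otimes>\<^bsub>G\<^esub>) w \<one>\<^bsub>G\<^esub>"

definition semigroup_generates :: "('a, 'b) monoid_scheme \<Rightarrow> 'a set \<Rightarrow> bool" where
  "semigroup_generates G S \<longleftrightarrow>
     S \<subseteq> carrier G \<and> carrier G = {word_prod G w | w. set w \<subseteq> S \<and> w \<noteq> []}"

definition growth :: "('a, 'b) monoid_scheme \<Rightarrow> 'a set \<Rightarrow> real \<Rightarrow> real" where
  "growth G S R = real (card {g \<in> carrier G. \<exists>w. set w \<subseteq> S \<and> real (length w) \<le> R \<and> g = word_prod G w})"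

definition growth_equiv :: "(real \<Rightarrow> real) \<Rightarrow> (real \<Rightarrow> real) \<Rightarrow> bool" (infix \<open>\<sim>\<^sub>g\<close> 50) where
  "v \<sim>\<^sub>g v' \<longleftrightarrow> (\<exists>C>0. \<forall>\<^sub>F R in at_top. v R \<le> v' (C * R) \<and> v' R \<le> v (C * R))"

text \<open>Monotonicity up to rescaling of the argument; every function that is nondecreasing on large
  arguments has it (take \<open>C = 1\<close>). By \<open>growth_equiv_imp_coarsely_mono\<close> below, it is necessary
  for being equivalent to a growth function. It does not follow from
  \<open>f (2 * R) \<le> (f R)\<^sup>2 \<le> f (\<eta> * R)\<close>: if \<open>L\<close> is a discontinuous additive function
  with \<open>L (ln 2) = L (ln \<eta>) = ln 2\<close>, then \<open>f R = exp (exp (L (ln R)))\<close> satisfies both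
  inequalities with equality, but is unbounded on every interval.\<close>

definition coarsely_mono :: "(real \<Rightarrow> real) \<Rightarrow> bool" where
  "coarsely_mono f \<longleftrightarrow> (\<exists>C>0. \<forall>\<^sub>F R in at_top. \<forall>S\<ge>R. f R \<le> f (C * S))"

definition eta_plus :: real where
  "eta_plus = (THE x. x > 0 \<and> x ^ 3 - x\<^sup>2 - 2 * x - 4 = 0)"

lemma ex1_eta_plus: "\<exists>!x::real. x > 0 \<and> x ^ 3 - x\<^sup>2 - 2 * x - 4 = 0"
proof -
  let ?p = "\<lambda>x::real. x ^ 3 - x\<^sup>2 - 2 * x - 4"
  have "\<exists>x. 0 \<le> x \<and> x \<le> 3 \<and> ?p x = 0"
    by (rule IVT') (auto intro!: continuous_intros)
  then obtain x where x: "0 \<le> x" "?p x = 0" by blast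
  hence "x > 0" by (cases "x = 0") auto
  moreover have "y = x" if y: "y > 0" "?p y = 0" and x': "x > 0" "?p x = 0" for x y
  proof (rule ccontr)
    assume "y \<noteq> x"
    have q: "1 = 1 / z + 2 / z\<^sup>2 + 4 / z ^ 3" if "z > 0" "?p z = 0" for z
    proof -
      have "1 / z + 2 / z\<^sup>2 + 4 / z ^ 3 = (z\<^sup>2 + 2 * z + 4) / z ^ 3"
        using that(1) by (simp add: divide_simps power2_eq_square power3_eq_cube algebra_simps)
      also have "z\<^sup>2 + 2 * z + 4 = z ^ 3" using that(2) by simp
      finally show ?thesis using that(1) by simp
    qed
    have lt: "1 / b + 2 / b\<^sup>2 + 4 / b ^ 3 < 1 / a + 2 / a\<^sup>2 + 4 / a ^ 3"
      if "0 < a" "a < b" for a b :: real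
      using that by (intro add_strict_mono divide_strict_left_mono power_strict_mono) auto
    show False
      using q[OF y] q[OF x'] lt[of x y] lt[of y x] \<open>y \<noteq> x\<close> y x' by linarith
  qed
  ultimately show ?thesis using x by blast
qed

lemma eta_plus: "eta_plus > 0" "eta_plus ^ 3 - eta_plus\<^sup>2 - 2 * eta_plus - 4 = 0"
  using theI'[OF ex1_eta_plus] unfolding eta_plus_def by blast+

lemma finite_ball:
  assumes "finite S"
  shows "finite {g \<in> carrier G. \<exists>w. set w \<subseteq> S \<and> real (length w) \<le> R \<and> g = word_prod G w}"
proof (rule finite_subset)
  show "{g \<in> carrier G. \<exists>w. set w \<subseteq> S \<and> real (length w) \<le> R \<and> g = word_prod G w}
    \<subseteq> word_prod G ` {w. set w \<subseteq> S \<and> length w \<le> nat \<lfloor>R\<rfloor>}"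
    by (auto simp: le_nat_floor)
  show "finite (word_prod G ` {w. set w \<subseteq> S \<and> length w \<le> nat \<lfloor>R\<rfloor>})"
    using finite_lists_length_le[OF assms] by blast
qed

lemma growth_mono:
  assumes "finite S" "R \<le> R'"
  shows "growth G S R \<le> growth G S R'"
  unfolding growth_def of_nat_le_iff
  by (rule card_mono[OF finite_ball[OF assms(1)]]) (use assms(2) in force)

lemma growth_equiv_imp_coarsely_mono:
  assumes "finite S" "growth G S \<sim>\<^sub>g f"
  shows "coarsely_mono f"
proof -
  obtain C N where C: "C > 0"
    and N: "\<And>R. R \<ge> N \<Longrightarrow> growth G S R \<le> f (C * R) \<and> f R \<le> growth G S (C * R)"
    using assms(2) unfolding growth_equiv_def eventually_at_top_linorder by blast
  have "f R \<le> f (C * C * T)" if "R \<ge> max N (N / C)" "T \<ge> R" for R T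
  proof -
    have 1: "f R \<le> growth G S (C * R)" using N that by auto
    have 2: "growth G S (C * R) \<le> growth G S (C * T)"
      using C that by (intro growth_mono assms) auto
    have "N \<le> C * R" using C that(1) by (simp add: field_simps)
    hence "N \<le> C * T" using C that(2) by (meson mult_left_mono less_imp_le order_trans)
    hence "growth G S (C * T) \<le> f (C * (C * T))" using N by blast
    with 1 2 show ?thesis by (simp add: mult.assoc)
  qed
  thus ?thesis unfolding coarsely_mono_def eventually_at_top_linorder
    using C by (intro exI[of _ "C * C"] conjI exI[of _ "max N (N / C)"]) auto
qed

end

theory Submission
  imports Defs "HOL-Library.Countable_Set" "HOL-Library.Cardinality"
begin

text \<open>
The group is a permutational wreath product: a group of order two, the lamp, over the action of a
Grigorchuk group on the orbit of the sequence \<open>111...\<close> in the boundary of the binary tree.  It is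
generated by the flip a of the first bit and by the letters: an element of the Klein four-group
\<open>{1, b, c, d}\<close>, possibly times the switching of the lamp above \<open>111...\<close>.  The spine, a sequence of
letters, says which of b, c, d is killed at each level.  Restricting an
element to the two halves of the tree gives two elements of the group for the shifted spine.

Both growth bounds come from the same weights.  Give weight 1 to each of b, c, d, and at each level of
the tree replace the weight of the killed letter by the sum of the three weights and double the two
others.  Let \<open>S\<^sub>k\<close> be the sum of the weights after k levels.

Upper bound (\<open>weigh_sections\<close>, \<open>card_ball_upper\<close>): the \<open>2\<^sup>k\<close> sections at level k of a word of
length n have total weight at most \<open>2\<^sup>k (n + S\<^sub>k)\<close>.  If the three weights are comparable and
\<open>n \<le> S\<^sub>k\<close>, the sections have \<open>O(2\<^sup>k)\<close> letters altogether, so the ball of radius n has at most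
\<open>exp (O(2\<^sup>k))\<close> elements.

Lower bound (\<open>substitute_sections\<close>, \<open>card_ball_lower\<close>): replace each letter x that is not killed by xx and
the killed letter by itself between the two others.  Both sections of the new word are the old word,
with lamps that can be switched independently, so each substitution squares the number of elements
that one gets from a word by switching lamps.  Lengths grow exactly as the weights do, and k
substitutions of one letter give \<open>2 ^ 2\<^sup>k\<close> elements of length at most \<open>2 S\<^sub>k\<close>.

Thus the growth at \<open>S\<^sub>k\<close> is about \<open>exp (2\<^sup>k)\<close>, and it remains to find a spine for which \<open>ln (f S\<^sub>k)\<close> is
comparable to \<open>2\<^sup>k\<close>.  If the same letter is always killed, \<open>S\<^sub>k\<close> grows as \<open>2\<^sup>k\<close>; if the letters are killed
cyclically, it grows as \<open>eta_plus\<^sup>k\<close>, because the polynomial of \<open>eta_plus\<close> is the characteristic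
polynomial of one step followed by the cyclic renaming of the letters.  These are the extreme rates
that the hypothesis on f permits.  The spine is chosen greedily, three levels at a time: cyclically
while \<open>ln (f S\<^sub>k)\<close> is behind \<open>2\<^sup>k\<close>, constantly otherwise.  Each kind of block multiplies some
functional comparable to the mass by exactly the right factor, so the errors in a long run of
blocks do not accumulate (\<open>slow_invariant\<close>, \<open>fast_invariant\<close>).  If \<open>ln f\<close> has a zero among the large
arguments, f is 1 from some point on, and the trivial group serves.
\<close>

section \<open>Groups generated by finitely many involutions\<close>

definition comp_list :: "('y \<Rightarrow> 'y) list \<Rightarrow> 'y \<Rightarrow> 'y" where
  "comp_list w = foldr (\<circ>) w id"

lemma comp_list_simps [simp]: "comp_list [] = id" "comp_list (g # w) = g \<circ> comp_list w"
  by (simp_all add: comp_list_def)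

lemma comp_list_append: "comp_list (u @ w) = comp_list u \<circ> comp_list w"
  by (induction u) (auto simp: comp_assoc)

text \<open>Because the generators are involutions, the semigroup that they generate is closed under inverses,
and because there are finitely many of them it is countable: numbering its elements
transports it to \<open>nat\<close>.\<close>

lemma involutions_generate_group:
  fixes T :: "('y \<Rightarrow> 'y) set"
  assumes fin: "finite T" and ne: "T \<noteq> {}" and inv: "\<And>g. g \<in> T \<Longrightarrow> g \<circ> g = id"
  shows "\<exists>(G :: nat monoid) S. group G \<and> finite S \<and> semigroup_generates G S \<and>
    (\<forall>R. growth G S R = real (card {comp_list w | w. set w \<subseteq> T \<and> real (length w) \<le> R}))"
proof -
  define M where "M = {comp_list w | w. set w \<subseteq> T}"
  define \<iota> where "\<iota> = to_nat_on M"
  define \<kappa> where "\<kappa> = inv_into M \<iota>"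
  define G :: "nat monoid" where
    "G = \<lparr>carrier = \<iota> ` M, mult = (\<lambda>x y. \<iota> (\<kappa> x \<circ> \<kappa> y)), one = \<iota> id\<rparr>"
  have "M = comp_list ` lists T" by (auto simp: M_def lists_eq_set)
  hence "countable M" using fin by (simp add: countable_finite)
  hence inj: "inj_on \<iota> M" by (simp add: \<iota>_def inj_on_to_nat_on)
  have \<kappa>: "\<kappa> (\<iota> g) = g" if "g \<in> M" for g using inj that by (simp add: \<kappa>_def)
  have id_M: "id \<in> M" unfolding M_def by (intro CollectI exI[of _ "[]"]) auto
  have comp_M: "g \<circ> h \<in> M" if gh: "g \<in> M" "h \<in> M" for g h
  proof -
    obtain u w where "g = comp_list u" "h = comp_list w" "set u \<subseteq> T" "set w \<subseteq> T"
      using gh by (auto simp: M_def)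
    thus ?thesis unfolding M_def
      by (intro CollectI exI[of _ "u @ w"]) (auto simp: comp_list_append)
  qed
  have T_M: "T \<subseteq> M" unfolding M_def by (auto intro!: exI[of _ "[_]"])
  have left_inv: "\<exists>h\<in>M. h \<circ> g = id" if gM: "g \<in> M" for g
  proof -
    have "comp_list (rev w) \<circ> comp_list w = id" if "set w \<subseteq> T" for w
      using that
    proof (induction w)
      case (Cons t w)
      have "comp_list (rev (t # w)) \<circ> comp_list (t # w) = comp_list (rev w) \<circ> (t \<circ> t) \<circ> comp_list w"
        by (simp add: comp_list_append comp_assoc)
      also have "\<dots> = comp_list (rev w) \<circ> comp_list w"
        using inv[of t] Cons.prems by (simp only: list.set insert_subset comp_id)
      finally show ?case using Cons by (simp only: list.set insert_subset)
    qed simp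
    moreover obtain w where "g = comp_list w" "set w \<subseteq> T" using gM by (auto simp: M_def)
    ultimately show ?thesis by (intro bexI[of _ "comp_list (rev w)"]) (auto simp: M_def intro!: exI[of _ "rev w"])
  qed
  have [simp]: "carrier G = \<iota> ` M" "\<one>\<^bsub>G\<^esub> = \<iota> id" by (simp_all add: G_def)
  have mult: "\<iota> g \<otimes>\<^bsub>G\<^esub> \<iota> h = \<iota> (g \<circ> h)" if "g \<in> M" "h \<in> M" for g h
    using that by (simp add: G_def \<kappa>)
  have grp: "group G"
  proof (rule groupI)
    fix x assume "x \<in> carrier G"
    then obtain g where g: "x = \<iota> g" "g \<in> M" by auto
    obtain h where "h \<in> M" "h \<circ> g = id" using left_inv[OF g(2)] by blast
    thus "\<exists>y\<in>carrier G. y \<otimes>\<^bsub>G\<^esub> x = \<one>\<^bsub>G\<^esub>"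
      using g by (intro bexI[of _ "\<iota> h"]) (auto simp: mult)
  qed (auto simp: mult comp_M id_M comp_assoc)
  define S where "S = \<iota> ` T"
  have wp: "word_prod G (map \<iota> w) = \<iota> (comp_list w) \<and> comp_list w \<in> M" if "set w \<subseteq> T" for w
    using that
  proof (induction w)
    case (Cons t w)
    hence "t \<in> M" using T_M by auto
    hence "\<iota> t \<otimes>\<^bsub>G\<^esub> \<iota> (comp_list w) = \<iota> (t \<circ> comp_list w)" "t \<circ> comp_list w \<in> M"
      using Cons by (auto intro!: mult comp_M)
    with Cons show ?case by (simp add: word_prod_def comp_def)
  qed (auto simp: word_prod_def id_M)
  have words: "{w. set w \<subseteq> S} = map \<iota> ` {w. set w \<subseteq> T}"
    using lists_image[of \<iota> T] by (simp add: S_def lists_eq_set)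
  have wordsE: "\<exists>w'. w = map \<iota> w' \<and> set w' \<subseteq> T" if "set w \<subseteq> S" for w
    using that words by (metis (mono_tags, lifting) image_iff mem_Collect_eq)
  have gen: "semigroup_generates G S"
    unfolding semigroup_generates_def
  proof
    show "S \<subseteq> carrier G" using T_M by (auto simp: S_def)
    obtain t where t: "t \<in> T" using ne by blast
    show "carrier G = {word_prod G w |w. set w \<subseteq> S \<and> w \<noteq> []}"
    proof (intro equalityI subsetI)
      fix x assume "x \<in> carrier G"
      then obtain w where w: "x = \<iota> (comp_list w)" "set w \<subseteq> T" by (auto simp: M_def)
      \<comment> \<open>Prepending \<open>t t = id\<close> turns the empty word into a nonempty one.\<close>
      have "comp_list (t # t # w) = comp_list w" using inv[OF t] by (simp add: comp_assoc[symmetric])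
      hence "x = word_prod G (map \<iota> (t # t # w))" using wp[of "t # t # w"] w t by simp
      thus "x \<in> {word_prod G w |w. set w \<subseteq> S \<and> w \<noteq> []}" using w t
        by (intro CollectI exI[of _ "map \<iota> (t # t # w)"]) (auto simp: S_def)
    next
      fix x assume "x \<in> {word_prod G w |w. set w \<subseteq> S \<and> w \<noteq> []}"
      then obtain w where "x = word_prod G (map \<iota> w)" "set w \<subseteq> T" using wordsE by blast
      thus "x \<in> carrier G" using wp by auto
    qed
  qed
  have "growth G S R = real (card {comp_list w | w. set w \<subseteq> T \<and> real (length w) \<le> R})" for R
  proof -
    let ?B = "{comp_list w | w. set w \<subseteq> T \<and> real (length w) \<le> R}"
    have "{g \<in> carrier G. \<exists>w. set w \<subseteq> S \<and> real (length w) \<le> R \<and> g = word_prod G w} = \<iota> ` ?B"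
    proof (intro equalityI subsetI)
      fix x assume "x \<in> {g \<in> carrier G. \<exists>w. set w \<subseteq> S \<and> real (length w) \<le> R \<and> g = word_prod G w}"
      then obtain w where "x = word_prod G w" "set w \<subseteq> S" "real (length w) \<le> R" by blast
      moreover then obtain w' where "w = map \<iota> w'" "set w' \<subseteq> T" using wordsE by blast
      ultimately show "x \<in> \<iota> ` ?B" using wp by auto
    next
      fix x assume "x \<in> \<iota> ` ?B"
      then obtain w where w: "x = \<iota> (comp_list w)" "set w \<subseteq> T" "real (length w) \<le> R" by auto
      thus "x \<in> {g \<in> carrier G. \<exists>w. set w \<subseteq> S \<and> real (length w) \<le> R \<and> g = word_prod G w}"
        using wp[of w] by (intro CollectI conjI exI[of _ "map \<iota> w"]) (auto simp: S_def)
    qed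
    moreover have "inj_on \<iota> ?B" by (rule inj_on_subset[OF inj]) (auto simp: M_def)
    ultimately show ?thesis by (simp add: growth_def card_image)
  qed
  moreover have "finite S" using fin by (simp add: S_def)
  ultimately show ?thesis using grp gen by blast
qed

section \<open>A lamp group over an action on the binary tree\<close>

text \<open>The three nonzero elements of the Klein four-group are the letters b, c, d of Grigorchuk's
construction.  The lamp is the second component of a \<open>point\<close>; only above the constant sequence
\<open>True\<close> does it change.\<close>

type_synonym klein = "bool \<times> bool"
type_synonym point = "(nat \<Rightarrow> bool) \<times> bool"

definition klein_add :: "klein \<Rightarrow> klein \<Rightarrow> klein" where
  "klein_add q r = (fst q \<noteq> fst r, snd q \<noteq> snd r)"

abbreviation kzero :: klein where "kzero \<equiv> (False, False)"

text \<open>For \<open>\<kappa> \<noteq> kzero\<close> this is the homomorphism onto a group of order two with kernel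
\<open>{kzero, \<kappa>}\<close>: the letter \<open>\<kappa>\<close> is killed at a level of the tree, and the two others act
there by a flip.\<close>

definition alive :: "klein \<Rightarrow> klein \<Rightarrow> bool" where
  "alive \<kappa> q \<longleftrightarrow> q \<noteq> kzero \<and> q \<noteq> \<kappa>"

definition letter_add :: "klein \<times> bool \<Rightarrow> klein \<times> bool \<Rightarrow> klein \<times> bool" where
  "letter_add k l = (klein_add (fst k) (fst l), snd k \<noteq> snd l)"

fun flip :: "point \<Rightarrow> point" where
  "flip (x, t) = (x(0 := \<not> x 0), t)"

definition first_zero :: "(nat \<Rightarrow> bool) \<Rightarrow> nat" where
  "first_zero x = (LEAST j. \<not> x j)"

text \<open>A letter is a pair \<open>(q, e)\<close>: the element \<open>q\<close> of the Klein group moves the sequences that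
contain a zero, and \<open>e\<close> switches the lamp above the constant sequence \<open>True\<close>, which \<open>q\<close> fixes.
The sequence \<open>\<omega>\<close>, called the spine, names the letter that is killed at each level.  Letters
commute with each other, lamps included.\<close>

fun act :: "(nat \<Rightarrow> klein) \<Rightarrow> klein \<times> bool \<Rightarrow> point \<Rightarrow> point" where
  "act \<omega> (q, e) (x, t) =
    (if \<forall>n. x n then (x, t \<noteq> e)
     else if alive (\<omega> (first_zero x)) q
     then (x(Suc (first_zero x) := \<not> x (Suc (first_zero x))), t)
     else (x, t))"

lemma first_zero_props:
  assumes "\<not> (\<forall>n. x n)"
  shows "\<not> x (first_zero x)" "\<And>i. i < first_zero x \<Longrightarrow> x i"
proof -
  show "\<not> x (first_zero x)" unfolding first_zero_def by (rule LeastI_ex) (use assms in blast)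
  show "x i" if "i < first_zero x" for i
    using not_less_Least[OF that[unfolded first_zero_def]] by blast
qed

lemma first_zero_eqI:
  assumes "\<not> x j" "\<And>i. i < j \<Longrightarrow> x i"
  shows "first_zero x = j"
  unfolding first_zero_def
  by (rule Least_equality) (use assms not_le in blast)+

lemma alive_add:
  assumes "\<kappa> \<noteq> kzero"
  shows "alive \<kappa> (klein_add q r) \<longleftrightarrow> alive \<kappa> q \<noteq> alive \<kappa> r"
  using assms by (cases \<kappa>; cases q; cases r) (auto simp: alive_def klein_add_def)

lemma act_add:
  assumes "\<And>i. \<omega> i \<noteq> kzero"
  shows "act \<omega> k \<circ> act \<omega> l = act \<omega> (letter_add k l)"
proof
  fix y :: point
  obtain q e where k: "k = (q, e)" by (cases k)
  obtain r e' where l: "l = (r, e')" by (cases l)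
  obtain x t where y: "y = (x, t)" by (cases y)
  show "(act \<omega> k \<circ> act \<omega> l) y = act \<omega> (letter_add k l) y"
  proof (cases "\<forall>n. x n")
    case True
    thus ?thesis by (auto simp: k l y letter_add_def)
  next
    case False
    define j where "j = first_zero x"
    have j: "\<not> x j" "\<And>i. i < j \<Longrightarrow> x i" using first_zero_props[OF False] by (auto simp: j_def)
    \<comment> \<open>The flip happens strictly behind the first zero, so it does not move it.\<close>
    have j': "first_zero (x(Suc j := b)) = j" for b
      by (rule first_zero_eqI) (use j in auto)
    have nz: "\<not> (\<forall>n. (x(Suc j := b)) n)" for b using j(1) by (metis fun_upd_other n_not_Suc_n)
    have 1: "act \<omega> (q', d) (x, t) = (if alive (\<omega> j) q' then (x(Suc j := \<not> x (Suc j)), t) else (x, t))"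
      for q' d using False by (auto simp: j_def)
    have 2: "act \<omega> (q', d) (x(Suc j := b), t) =
        (if alive (\<omega> j) q' then (x(Suc j := \<not> b), t) else (x(Suc j := b), t))"
      for q' d b using nz[of b] by (simp only: act.simps j' if_False) auto
    show ?thesis
      by (simp add: k l y letter_add_def 1 2 alive_add[OF assms] del: act.simps)
  qed
qed

lemma act_zero: "act \<omega> (kzero, False) = id"
proof
  fix y :: point
  show "act \<omega> (kzero, False) y = id y" by (cases y) (auto simp: alive_def)
qed

lemma act_involution:
  assumes "\<And>i. \<omega> i \<noteq> kzero"
  shows "act \<omega> k \<circ> act \<omega> k = id"
  using act_add[of \<omega> k k, OF assms] act_zero[of \<omega>] by (simp add: letter_add_def klein_add_def)

lemma flip_involution: "flip \<circ> flip = id"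
proof
  fix y :: point
  show "(flip \<circ> flip) y = id y" by (cases y) auto
qed

text \<open>The permutation that permutes the two halves of the tree according to \<open>\<epsilon>\<close> and acts on them
by \<open>u\<close> and \<open>v\<close>.  The sections \<open>u\<close> and \<open>v\<close> are indexed by the half in which the image lies, not
by the half of the argument: then multiplying by a letter on the left multiplies the sections on
the left.\<close>

definition node :: "bool \<Rightarrow> (point \<Rightarrow> point) \<Rightarrow> (point \<Rightarrow> point) \<Rightarrow> point \<Rightarrow> point" where
  "node \<epsilon> u v y = (let h = (fst y 0 \<noteq> \<epsilon>); z = (if h then v else u) (\<lambda>n. fst y (Suc n), snd y)
     in (case_nat h (fst z), snd z))"

lemma node_comp:
  "node \<delta> u v \<circ> node \<epsilon> u' v' =
     node (\<delta> \<noteq> \<epsilon>) (u \<circ> (if \<delta> then v' else u')) (v \<circ> (if \<delta> then u' else v'))"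
  by (rule ext) (auto simp: node_def Let_def)

lemma flip_eq_node: "flip = node True id id"
proof
  fix y :: point
  show "flip y = node True id id y"
    by (cases y) (auto simp: node_def Let_def fun_eq_iff split: nat.splits)
qed

text \<open>The self-similarity on which everything rests: a letter acts on the second half as the same
letter for the shifted spine, lamp included, and on the first half as a flip or not at all.\<close>

lemma act_eq_node:
  "act \<omega> k = node False (if alive (\<omega> 0) (fst k) then flip else id) (act (\<lambda>i. \<omega> (Suc i)) k)"
proof
  fix y :: point
  obtain q e where k: "k = (q, e)" by (cases k)
  obtain x t where y: "y = (x, t)" by (cases y)
  define x' where "x' = (\<lambda>n. x (Suc n))"
  show "act \<omega> k y =
    node False (if alive (\<omega> 0) (fst k) then flip else id) (act (\<lambda>i. \<omega> (Suc i)) k) y"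
  proof (cases "x 0")
    case False
    hence "first_zero x = 0" by (intro first_zero_eqI) auto
    with False show ?thesis
      by (auto simp: k y node_def Let_def fun_eq_iff split: nat.splits)
  next
    case x0: True
    show ?thesis
    proof (cases "\<forall>n. x n")
      case True
      thus ?thesis by (auto simp: k y node_def Let_def fun_eq_iff split: nat.splits)
    next
      case False
      hence F': "\<not> (\<forall>n. x' n)" using x0 unfolding x'_def by (metis not0_implies_Suc)
      have fz: "first_zero x = Suc (first_zero x')"
      proof (rule first_zero_eqI)
        show "\<not> x (Suc (first_zero x'))" using first_zero_props(1)[OF F'] by (simp add: x'_def)
        show "x i" if "i < Suc (first_zero x')" for i
          using that first_zero_props(2)[OF F'] x0 by (cases i) (auto simp: x'_def)
      qed
      show ?thesis using x0 False F' fz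
        by (auto simp: k y node_def Let_def fun_eq_iff x'_def[symmetric] split: nat.splits)
           (auto simp: x'_def)
    qed
  qed
qed

lemma node_eq_iff: "node \<epsilon> u v = node \<epsilon> u' v' \<longleftrightarrow> u = u' \<and> v = v'"
proof
  assume eq: "node \<epsilon> u v = node \<epsilon> u' v'"
  have "u y = u' y \<and> v y = v' y" for y
  proof -
    have sect: "(if h then v else u) y =
        ((\<lambda>n. fst (node \<epsilon> u v (case_nat (h \<noteq> \<epsilon>) (fst y), snd y)) (Suc n)),
         snd (node \<epsilon> u v (case_nat (h \<noteq> \<epsilon>) (fst y), snd y)))" for h u v
      by (cases h; cases \<epsilon>) (auto simp: node_def Let_def)
    show ?thesis using sect[of False v u] sect[of False v' u'] sect[of True v u] sect[of True v' u'] eq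
      by simp
  qed
  thus "u = u' \<and> v = v'" by auto
qed auto

section \<open>Weights of letters, sections of words, and portraits\<close>

type_synonym weight = "klein \<Rightarrow> real"

definition mass :: "weight \<Rightarrow> real" where
  "mass W = W (True, False) + W (False, True) + W (True, True)"

text \<open>The weights that measure words one level further down the tree.  The killed letter gets the weight
of all three letters because it takes all three of them, as in \<open>substitute\<close>, to produce it in both
halves; any other letter is produced by two copies of itself.\<close>

definition push :: "klein \<Rightarrow> weight \<Rightarrow> weight" where
  "push \<kappa> W q = (if q = kzero then 0 else if q = \<kappa> then mass W else 2 * W q)"

fun push_iter :: "(nat \<Rightarrow> klein) \<Rightarrow> weight \<Rightarrow> nat \<Rightarrow> weight" where
  "push_iter \<omega> W 0 = W"
| "push_iter \<omega> W (Suc k) = push_iter (\<lambda>i. \<omega> (Suc i)) (push (\<omega> 0) W) k"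

text \<open>No letter weighs more than the two others together.  This is what makes the cost of a flip and the
reduced weights in \<open>weigh_sections\<close> nonnegative; it survives every push.\<close>

definition triangular :: "weight \<Rightarrow> bool" where
  "triangular W \<longleftrightarrow> W kzero = 0 \<and> (\<forall>q. 0 \<le> W q \<and> 2 * W q \<le> mass W)"

definition unit_weight :: weight where
  "unit_weight q = (if q = kzero then 0 else 1)"

lemma klein_cases:
  fixes q :: klein
  obtains "q = kzero" | "q = (True, False)" | "q = (False, True)" | "q = (True, True)"
  by (metis (full_types) surj_pair)

lemma triangularD:
  assumes "triangular W"
  shows "0 \<le> W q" "2 * W q \<le> mass W" "W kzero = 0"
  using assms unfolding triangular_def by blast+

lemma triangular_push:
  assumes W: "triangular W" and \<kappa>: "\<kappa> \<noteq> kzero"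
  shows "triangular (push \<kappa> W)" "2 * mass W \<le> mass (push \<kappa> W)" "mass (push \<kappa> W) \<le> 3 * mass W"
proof -
  note W' = triangularD(1,2)[OF W, of "(True, False)"] triangularD(1,2)[OF W, of "(False, True)"]
    triangularD(1,2)[OF W, of "(True, True)"]
  show 1: "2 * mass W \<le> mass (push \<kappa> W)"
    by (cases \<kappa> rule: klein_cases) (use W' \<kappa> in \<open>simp_all add: push_def mass_def\<close>)
  show "mass (push \<kappa> W) \<le> 3 * mass W"
    by (cases \<kappa> rule: klein_cases) (use W' \<kappa> in \<open>simp_all add: push_def mass_def\<close>)
  have "0 \<le> push \<kappa> W q \<and> 2 * push \<kappa> W q \<le> mass (push \<kappa> W)" for q
  proof (cases "alive \<kappa> q")
    case True
    show ?thesis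
      by (cases \<kappa> rule: klein_cases; cases q rule: klein_cases)
        (use W' \<kappa> True in \<open>simp_all add: push_def mass_def alive_def\<close>)
  next
    case False
    thus ?thesis using 1 W' by (auto simp: push_def alive_def mass_def)
  qed
  thus "triangular (push \<kappa> W)" by (simp add: triangular_def push_def)
qed

lemma triangular_unit_weight: "triangular unit_weight"
  by (auto simp: triangular_def unit_weight_def mass_def)

text \<open>The pair \<open>(k, [k\<^sub>1, ..., k\<^sub>r])\<close> stands for the product
\<open>k a k\<^sub>1 a ... a k\<^sub>r\<close>, where a is the flip.  Adjacent letters are thus always merged into one,
which is where words get shorter when they are split into sections.\<close>

type_synonym syll = "(klein \<times> bool) \<times> (klein \<times> bool) list"

definition eval :: "(nat \<Rightarrow> klein) \<Rightarrow> syll \<Rightarrow> point \<Rightarrow> point" where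
  "eval \<omega> x = act \<omega> (fst x) \<circ> foldr (\<lambda>k g. flip \<circ> act \<omega> k \<circ> g) (snd x) id"

definition mul_letter :: "klein \<times> bool \<Rightarrow> syll \<Rightarrow> syll" where
  "mul_letter k x = (letter_add k (fst x), snd x)"

definition mul_flip :: "syll \<Rightarrow> syll" where
  "mul_flip x = ((kzero, False), fst x # snd x)"

lemma eval_Nil: "eval \<omega> (k, []) = act \<omega> k"
  by (simp add: eval_def)

lemma eval_Cons: "eval \<omega> (k, k' # ks) = act \<omega> k \<circ> (flip \<circ> eval \<omega> (k', ks))"
  by (simp add: eval_def comp_assoc)

lemma eval_mul_letter:
  assumes "\<And>i. \<omega> i \<noteq> kzero"
  shows "eval \<omega> (mul_letter k x) = act \<omega> k \<circ> eval \<omega> x"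
  using act_add[of \<omega>, OF assms, symmetric] by (simp add: eval_def mul_letter_def comp_assoc)

lemma eval_mul_flip: "eval \<omega> (mul_flip x) = flip \<circ> eval \<omega> x"
  by (cases x) (simp add: mul_flip_def eval_Cons act_zero)

text \<open>The sections of \<open>k a k\<^sub>1 a ... a k\<^sub>r\<close>.  A letter goes to the second half and leaves a flip in
the first one if it is alive, and the following a exchanges the halves.\<close>

fun sections :: "klein \<Rightarrow> klein \<times> bool \<Rightarrow> (klein \<times> bool) list \<Rightarrow> syll \<times> syll" where
  "sections \<kappa> k [] =
     ((if alive \<kappa> (fst k) then mul_flip ((kzero, False), []) else ((kzero, False), [])), (k, []))"
| "sections \<kappa> k (k' # ks) =
     (let (u, v) = sections \<kappa> k' ks in
       ((if alive \<kappa> (fst k) then mul_flip v else v), mul_letter k u))"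

lemma eval_sections:
  assumes "\<And>i. \<omega> i \<noteq> kzero"
  shows "eval \<omega> (k, ks) = node (odd (length ks))
    (eval (\<lambda>i. \<omega> (Suc i)) (fst (sections (\<omega> 0) k ks)))
    (eval (\<lambda>i. \<omega> (Suc i)) (snd (sections (\<omega> 0) k ks)))"
proof (induction ks arbitrary: k)
  case Nil
  show ?case
    by (subst act_eq_node[of \<omega>, folded eval_Nil]) (auto simp: eval_Nil eval_mul_flip act_zero)
next
  case (Cons k' ks)
  obtain u v where uv: "sections (\<omega> 0) k' ks = (u, v)" by (cases "sections (\<omega> 0) k' ks")
  have ml: "eval (\<lambda>i. \<omega> (Suc i)) (mul_letter k x) = act (\<lambda>i. \<omega> (Suc i)) k \<circ> eval (\<lambda>i. \<omega> (Suc i)) x"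
    for k x using assms by (intro eval_mul_letter) auto
  show ?case
    unfolding eval_Cons Cons.IH uv flip_eq_node act_eq_node[of \<omega> k] node_comp
    by (auto simp: uv ml eval_mul_flip node_eq_iff flip_eq_node[symmetric])
qed

definition weigh :: "weight \<Rightarrow> syll \<Rightarrow> real" where
  "weigh W x = W (fst (fst x)) + (\<Sum>k\<leftarrow>snd x. W (fst k))"

lemma weigh_simps:
  "weigh W (k, []) = W (fst k)"
  "weigh W (k, k' # ks) = W (fst k) + weigh W (k', ks)"
  "W kzero = 0 \<Longrightarrow> weigh W (mul_flip x) = weigh W x"
  by (auto simp: weigh_def mul_flip_def)

definition subadditive :: "weight \<Rightarrow> bool" where
  "subadditive W \<longleftrightarrow> W kzero = 0 \<and> (\<forall>q r. W (klein_add q r) \<le> W q + W r)"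

lemma weigh_mul_letter:
  assumes "subadditive W"
  shows "weigh W (mul_letter k x) \<le> W (fst k) + weigh W x"
proof -
  have "W (klein_add (fst k) (fst (fst x))) \<le> W (fst k) + W (fst (fst x))"
    using assms unfolding subadditive_def by blast
  thus ?thesis by (simp add: weigh_def mul_letter_def letter_add_def)
qed

lemma length_simps [simp]:
  "length (snd (mul_letter k x)) = length (snd x)"
  "length (snd (mul_flip x)) = Suc (length (snd x))"
  by (auto simp: mul_letter_def mul_flip_def)

text \<open>The contraction estimate.  In the sections, charge \<open>\<alpha> = mass W - 2 * W \<kappa>\<close> for each flip and
\<open>\<mu> q = push \<kappa> W q - \<alpha>\<close> for each nontrivial letter \<open>q\<close>.  A letter \<open>q\<close> of the word then
costs at most \<open>2 * W q\<close> in both sections together: \<open>\<mu> q + \<alpha>\<close> if it is alive and \<open>\<mu> q\<close> if it is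
killed.  Merging letters is free because \<open>\<mu>\<close> is subadditive; here the triangle inequalities enter,
and the product of the two alive letters, which is the killed one, is a case of equality.  Charging
the flips to the letters beside them turns \<open>\<mu>\<close> back into \<open>push \<kappa> W\<close>, up to one \<open>\<alpha>\<close> for each
section, as a section has one letter more than it has flips.\<close>

lemma weigh_sections:
  assumes tri: "triangular W" and \<kappa>: "\<kappa> \<noteq> kzero" and uv: "sections \<kappa> k ks = (u, v)"
  shows "weigh (push \<kappa> W) u + weigh (push \<kappa> W) v \<le> 2 * weigh W (k, ks) + 2 * mass W"
proof -
  define \<alpha> where "\<alpha> = mass W - 2 * W \<kappa>"
  define \<mu> where "\<mu> q = (if q = kzero then 0 else push \<kappa> W q - \<alpha>)" for q
  have \<alpha>: "0 \<le> \<alpha>" "\<alpha> \<le> mass W"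
    using triangularD(1,2)[OF tri, of \<kappa>] by (simp_all add: \<alpha>_def)
  have sub: "subadditive \<mu>"
  proof -
    note W' = triangularD(1,2)[OF tri, of "(True, False)"] triangularD(1,2)[OF tri, of "(False, True)"]
      triangularD(1,2)[OF tri, of "(True, True)"]
    have "\<mu> (klein_add q r) \<le> \<mu> q + \<mu> r" for q r
      by (cases \<kappa> rule: klein_cases; cases q rule: klein_cases; cases r rule: klein_cases)
        (use W' \<kappa> in \<open>simp_all add: \<mu>_def push_def klein_add_def \<alpha>_def mass_def\<close>)
    thus ?thesis by (simp add: subadditive_def \<mu>_def)
  qed
  have z: "\<mu> kzero = 0" by (simp add: \<mu>_def)
  have letter: "\<mu> q + (if alive \<kappa> q then \<alpha> else 0) \<le> 2 * W q" for q
    using triangularD(1,2)[OF tri, of q] triangularD(3)[OF tri] \<kappa> by (auto simp: \<mu>_def push_def alive_def \<alpha>_def)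
  have len: "weigh (push \<kappa> W) x \<le> weigh \<mu> x + \<alpha> * (real (length (snd x)) + 1)" for x
  proof -
    have "push \<kappa> W q \<le> \<mu> q + \<alpha>" for q using \<alpha> by (auto simp: \<mu>_def push_def)
    hence "(\<Sum>k\<leftarrow>ks. push \<kappa> W (fst k)) \<le> (\<Sum>k\<leftarrow>ks. \<mu> (fst k)) + \<alpha> * real (length ks)"
      for ks :: "(klein \<times> bool) list"
      by (induction ks) (auto simp: algebra_simps intro: add_mono order_trans[OF add_mono])
    from this[of "snd x"] \<open>push \<kappa> W (fst (fst x)) \<le> \<mu> (fst (fst x)) + \<alpha>\<close> show ?thesis
      by (simp add: weigh_def algebra_simps)
  qed
  have "weigh \<mu> u + weigh \<mu> v + \<alpha> * (real (length (snd u)) + real (length (snd v)))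
      \<le> 2 * weigh W (k, ks)"
    using uv
  proof (induction ks arbitrary: k u v)
    case Nil
    thus ?case using letter[of "fst k"] z by (auto simp: weigh_simps mul_flip_def split: if_splits)
  next
    case (Cons k' ks)
    obtain u' v' where uv': "sections \<kappa> k' ks = (u', v')" by (cases "sections \<kappa> k' ks")
    note IH = Cons.IH[OF uv']
    have uv2: "u = (if alive \<kappa> (fst k) then mul_flip v' else v')" "v = mul_letter k u'"
      using Cons.prems uv' by auto
    show ?case using IH letter[of "fst k"] weigh_mul_letter[OF sub, of k u']
      unfolding uv2 by (auto simp: weigh_simps z algebra_simps)
  qed
  with len[of u] len[of v] \<alpha> show ?thesis by (simp add: algebra_simps)
qed

text \<open>The weight of a word does not see its pure lamp letters \<open>(kzero, True)\<close>, so it does not bound the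
number of syllables.  But only the letters alive at a level put flips into the sections: one level
further down, the number of syllables is under control as well.\<close>

definition support_size :: "syll \<Rightarrow> real" where
  "support_size = weigh (\<lambda>q. if q = kzero then 0 else 1)"

lemma length_sections:
  assumes "sections \<kappa> k ks = (u, v)"
  shows "real (length (snd u)) + real (length (snd v)) \<le> support_size (k, ks)"
  using assms
proof (induction ks arbitrary: k u v)
  case Nil
  thus ?case by (auto simp: support_size_def weigh_simps mul_flip_def alive_def split: if_splits)
next
  case (Cons k' ks)
  obtain u' v' where uv': "sections \<kappa> k' ks = (u', v')" by (cases "sections \<kappa> k' ks")
  note IH = Cons.IH[OF uv']
  have uv2: "u = (if alive \<kappa> (fst k) then mul_flip v' else v')" "v = mul_letter k u'"
    using Cons.prems uv' by auto
  show ?case using IH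
    unfolding uv2 by (auto simp: support_size_def weigh_simps alive_def)
qed

lemma support_size_le:
  assumes "c > 0" "\<And>q. q \<noteq> kzero \<Longrightarrow> c \<le> W q" "W kzero = 0"
  shows "support_size x \<le> weigh W x / c"
proof -
  have q: "(if q = kzero then 0 else 1) \<le> W q / c" for q
    using assms(2)[of q] assms(1,3) by (auto simp: field_simps)
  have "(\<Sum>k\<leftarrow>ks. if fst k = kzero then 0 else 1) \<le> (\<Sum>k\<leftarrow>ks. W (fst k)) / c"
    for ks :: "(klein \<times> bool) list"
  proof (induction ks)
    case (Cons k ks)
    thus ?case using q[of "fst k"] by (simp add: add_divide_distrib)
  qed simp
  from this[of "snd x"] q[of "fst (fst x)"] show ?thesis
    by (simp add: support_size_def weigh_def add_divide_distrib)
qed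

text \<open>An element is recorded by splitting it along a finite binary tree and writing down words for the
sections at the leaves.\<close>

datatype portrait = Leaf syll | Branch bool portrait portrait

fun realize :: "(nat \<Rightarrow> klein) \<Rightarrow> portrait \<Rightarrow> point \<Rightarrow> point" where
  "realize \<omega> (Leaf x) = eval \<omega> x"
| "realize \<omega> (Branch \<epsilon> l r) = node \<epsilon> (realize (\<lambda>i. \<omega> (Suc i)) l) (realize (\<lambda>i. \<omega> (Suc i)) r)"

text \<open>Portraits are counted through their Polish notation, a prefix-free code over a finite alphabet.\<close>

type_synonym token = "(bool + klein \<times> bool) option"

fun serialize :: "portrait \<Rightarrow> token list" where
  "serialize (Leaf x) = Some (Inr (fst x)) # map (\<lambda>k. Some (Inr k)) (snd x) @ [None]"
| "serialize (Branch \<epsilon> l r) = Some (Inl \<epsilon>) # serialize l @ serialize r"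

lemma serialize_prefix_free:
  "serialize p @ z = serialize p' @ z' \<Longrightarrow> p = p' \<and> z = z'"
proof (induction p arbitrary: p' z z')
  case (Leaf x)
  have *: "map (\<lambda>k. Some (Inr k)) ks @ None # z = map (\<lambda>k. Some (Inr k)) ks' @ None # z' \<Longrightarrow>
      ks = ks' \<and> z = z'" for ks ks' :: "(klein \<times> bool) list" and z z' :: "token list"
  proof (induction ks arbitrary: ks')
    case Nil thus ?case by (cases ks') auto
  next
    case (Cons k ks) thus ?case by (cases ks') auto
  qed
  from Leaf obtain x' where p': "p' = Leaf x'" by (cases p') auto
  with Leaf have 1: "fst x = fst x'" and 2:
    "map (\<lambda>k. Some (Inr k)) (snd x) @ None # z = map (\<lambda>k. Some (Inr k)) (snd x') @ None # z'"
    by simp_all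
  from *[OF 2] 1 have "x = x'" "z = z'" by (blast intro: prod_eqI)+
  with p' show ?case by blast
next
  case (Branch \<epsilon> l r)
  from Branch.prems obtain l' r' where p': "p' = Branch \<epsilon> l' r'" by (cases p') auto
  with Branch.prems have "serialize l @ serialize r @ z = serialize l' @ serialize r' @ z'" by simp
  with Branch.IH p' show ?case by blast
qed

lemma inj_serialize: "inj serialize"
  using serialize_prefix_free[of _ "[]" _ "[]"] by (auto intro!: injI)

text \<open>Split \<open>k\<close> times with \<open>weigh_sections\<close>, and once more with \<open>length_sections\<close>.  The error
\<open>2 * mass W\<close> in each splitting would add up; it is absorbed by carrying the quantity
\<open>weigh W x + mass V - mass W\<close>, since a push at least doubles the mass.
The portrait has \<open>2 ^ (k + 1)\<close> leaves, with two tokens each beside their syllables, and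
\<open>2 ^ (k + 1) - 1\<close> branchings, which makes the term \<open>6 * 2 ^ k - 1\<close>.\<close>

lemma ex_short_portrait:
  assumes "triangular W" "\<And>i. \<omega> i \<noteq> kzero" "V = push_iter \<omega> W k"
    and c: "c > 0" "\<And>q. q \<noteq> kzero \<Longrightarrow> c \<le> V q"
  shows "\<exists>p. realize \<omega> p = eval \<omega> x \<and>
    real (length (serialize p)) \<le> 6 * 2 ^ k - 1 + 2 ^ k * (weigh W x + mass V - mass W) / c"
  using assms(1-3)
proof (induction k arbitrary: \<omega> W x)
  case 0
  obtain u v where uv: "sections (\<omega> 0) (fst x) (snd x) = (u, v)"
    by (cases "sections (\<omega> 0) (fst x) (snd x)")
  have "eval \<omega> x = realize \<omega> (Branch (odd (length (snd x))) (Leaf u) (Leaf v))"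
    using eval_sections[of \<omega> "fst x" "snd x"] 0 uv by simp
  moreover have "support_size x \<le> weigh W x / c"
    using 0 c by (intro support_size_le) (auto simp: triangular_def)
  ultimately show ?case using length_sections[OF uv] 0
    by (intro exI[of _ "Branch (odd (length (snd x))) (Leaf u) (Leaf v)"]) auto
next
  case (Suc k)
  define \<omega>' W' where "\<omega>' = (\<lambda>i. \<omega> (Suc i))" and "W' = push (\<omega> 0) W"
  have W': "triangular W'" "2 * mass W \<le> mass W'"
    using triangular_push[OF Suc.prems(1), of "\<omega> 0"] Suc.prems by (auto simp: W'_def)
  obtain u v where uv: "sections (\<omega> 0) (fst x) (snd x) = (u, v)"
    by (cases "sections (\<omega> 0) (fst x) (snd x)")
  have IH: "\<exists>p. realize \<omega>' p = eval \<omega>' x \<and>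
      real (length (serialize p)) \<le> 6 * 2 ^ k - 1 + 2 ^ k * (weigh W' x + mass V - mass W') / c" for x
    using Suc.prems W' by (intro Suc.IH) (auto simp: \<omega>'_def W'_def)
  obtain l where l: "realize \<omega>' l = eval \<omega>' u"
    "real (length (serialize l)) \<le> 6 * 2 ^ k - 1 + 2 ^ k * (weigh W' u + mass V - mass W') / c"
    using IH by blast
  obtain r where r: "realize \<omega>' r = eval \<omega>' v"
    "real (length (serialize r)) \<le> 6 * 2 ^ k - 1 + 2 ^ k * (weigh W' v + mass V - mass W') / c"
    using IH by blast
  let ?p = "Branch (odd (length (snd x))) l r"
  have "eval \<omega> x = realize \<omega> ?p"
    using eval_sections[of \<omega> "fst x" "snd x"] Suc.prems uv l r by (simp add: \<omega>'_def)
  moreover have "weigh W' u + weigh W' v \<le> 2 * weigh W x + 2 * mass W"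
    using weigh_sections[OF _ _ uv] Suc.prems by (auto simp: W'_def)
  hence "(weigh W' u + mass V - mass W') + (weigh W' v + mass V - mass W')
      \<le> 2 * (weigh W x + mass V - mass W)" (is "?u + ?v \<le> 2 * ?x")
    using W'(2) by argo
  hence "2 ^ k * (?u + ?v) / c \<le> 2 ^ k * (2 * ?x) / c"
    using c(1) by (intro divide_right_mono mult_left_mono) auto
  hence "2 ^ k * ?u / c + 2 ^ k * ?v / c \<le> 2 ^ Suc k * ?x / c"
    by (simp only: distrib_left add_divide_distrib power_Suc mult.assoc mult.left_commute)
  hence "real (length (serialize ?p)) \<le> 6 * 2 ^ Suc k - 1 + 2 ^ Suc k * ?x / c"
    using l(2) r(2) by simp
  ultimately show ?case by (intro exI[of _ ?p]) simp
qed

section \<open>A substitution that doubles words on the tree\<close>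

text \<open>For a nonzero \<open>\<kappa>\<close>, one of the two other letters; their product is \<open>\<kappa>\<close>.\<close>

definition companion :: "klein \<Rightarrow> klein" where
  "companion \<kappa> = (snd \<kappa>, fst \<kappa> \<noteq> snd \<kappa>)"

text \<open>The words \<open>substitute \<kappa> qs\<close> have both sections equal to \<open>qs\<close>, up to flips at the ends: a
letter that is alive is read once in each half, and the killed letter is read by itself in one half
and as the product of its two neighbours in the other.\<close>

fun substitute :: "klein \<Rightarrow> klein list \<Rightarrow> klein list" where
  "substitute \<kappa> [] = []"
| "substitute \<kappa> (q # qs) =
     (if q = \<kappa> then [companion \<kappa>, \<kappa>, klein_add \<kappa> (companion \<kappa>)] else [q, q]) @ substitute \<kappa> qs"

text \<open>Here each letter is followed by a flip, so that concatenation of lists is composition.\<close>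

definition word_map :: "(nat \<Rightarrow> klein) \<Rightarrow> (klein \<times> bool) list \<Rightarrow> point \<Rightarrow> point" where
  "word_map \<omega> ks = comp_list (concat (map (\<lambda>k. [act \<omega> k, flip]) ks))"

lemma word_map_simps:
  "word_map \<omega> [] = id"
  "word_map \<omega> (k # ks) = act \<omega> k \<circ> (flip \<circ> word_map \<omega> ks)"
  by (simp_all only: word_map_def comp_list_simps list.map concat.simps append.simps)

lemma map_fst_ConsE:
  assumes "map fst X = q # qs"
  obtains e X' where "X = (q, e) # X'" "map fst X' = qs"
  using assms by (cases X) auto

lemma companion:
  assumes "\<kappa> \<noteq> kzero"
  shows "companion \<kappa> \<noteq> kzero" "companion \<kappa> \<noteq> \<kappa>"
    "klein_add \<kappa> (companion \<kappa>) \<noteq> kzero" "klein_add \<kappa> (companion \<kappa>) \<noteq> \<kappa>"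
    "klein_add (companion \<kappa>) (klein_add \<kappa> (companion \<kappa>)) = \<kappa>"
  using assms by (cases \<kappa> rule: klein_cases; simp add: companion_def klein_add_def)+

lemma letter_step:
  "act \<omega> k \<circ> (flip \<circ> node \<epsilon> u v) =
    node (\<not> \<epsilon>) (if alive (\<omega> 0) (fst k) then flip \<circ> v else v) (act (\<lambda>i. \<omega> (Suc i)) k \<circ> u)"
  unfolding flip_eq_node act_eq_node[of \<omega>] node_comp by (auto simp: flip_eq_node[symmetric])

text \<open>The lamp bits of the two sections can be prescribed independently.  The trailing factors \<open>c\<close> and
\<open>c'\<close> are each the identity or a flip; each killed letter exchanges the roles of the two halves, and
with them \<open>c\<close> and \<open>c'\<close>.\<close>

lemma substitute_sections:
  fixes \<omega> :: "nat \<Rightarrow> klein"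
  assumes \<omega>: "\<And>i. \<omega> i \<noteq> kzero" and "kzero \<notin> set qs"
  defines "\<omega>' \<equiv> (\<lambda>i. \<omega> (Suc i))"
  shows "\<exists>\<epsilon> c c'. c \<circ> c = id \<and> c' \<circ> c' = id \<and>
    (\<forall>X Y. map fst X = qs \<longrightarrow> map fst Y = qs \<longrightarrow>
      (\<exists>Z. map fst Z = substitute (\<omega> 0) qs \<and>
        word_map \<omega> Z = node \<epsilon> (flip \<circ> (word_map \<omega>' X \<circ> c)) (word_map \<omega>' Y \<circ> c')))"
  using assms(2)
proof (induction qs)
  case Nil
  have "id = node False (flip \<circ> flip) id"
    using flip_involution act_eq_node[of \<omega> "(kzero, False)"] act_zero by (simp add: alive_def)
  hence "word_map \<omega> [] = node False (flip \<circ> (word_map \<omega>' [] \<circ> flip)) (word_map \<omega>' [] \<circ> id)"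
    by (simp only: word_map_simps id_comp comp_id)
  hence "\<exists>Z. map fst Z = substitute (\<omega> 0) [] \<and>
        word_map \<omega> Z = node False (flip \<circ> (word_map \<omega>' [] \<circ> flip)) (word_map \<omega>' [] \<circ> id)"
    by (intro exI[of _ "[]"]) simp
  hence "\<forall>X Y. map fst X = [] \<longrightarrow> map fst Y = [] \<longrightarrow>
      (\<exists>Z. map fst Z = substitute (\<omega> 0) [] \<and>
        word_map \<omega> Z = node False (flip \<circ> (word_map \<omega>' X \<circ> flip)) (word_map \<omega>' Y \<circ> id))"
    by (simp only: map_is_Nil_conv) blast
  thus ?case using flip_involution comp_id[of id] by blast
next
  case (Cons q qs)
  hence "kzero \<notin> set qs" by simp
  from Cons.IH[OF this] obtain \<epsilon> c c' where c: "c \<circ> c = id" "c' \<circ> c' = id" and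
    IH: "\<And>X Y. map fst X = qs \<Longrightarrow> map fst Y = qs \<Longrightarrow>
      (\<exists>Z. map fst Z = substitute (\<omega> 0) qs \<and>
        word_map \<omega> Z = node \<epsilon> (flip \<circ> (word_map \<omega>' X \<circ> c)) (word_map \<omega>' Y \<circ> c'))"
    by blast
  let ?\<kappa> = "\<omega> 0"
  have \<omega>': "\<omega>' i \<noteq> kzero" for i using \<omega> by (simp add: \<omega>'_def)
  show ?case
  proof (cases "q = ?\<kappa>")
    case True
    have "\<exists>Z. map fst Z = substitute ?\<kappa> (q # qs) \<and>
        word_map \<omega> Z = node (\<not> \<epsilon>) (flip \<circ> (word_map \<omega>' X \<circ> c')) (word_map \<omega>' Y \<circ> c)"
      if XY: "map fst X = q # qs" "map fst Y = q # qs" for X Y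
    proof -
      obtain e X' where X: "X = (q, e) # X'" "map fst X' = qs" using XY(1) by (rule map_fst_ConsE)
      obtain e' Y' where Y: "Y = (q, e') # Y'" "map fst Y' = qs" using XY(2) by (rule map_fst_ConsE)
      obtain Z where Z: "map fst Z = substitute ?\<kappa> qs"
        "word_map \<omega> Z = node \<epsilon> (flip \<circ> (word_map \<omega>' Y' \<circ> c)) (word_map \<omega>' X' \<circ> c')"
        using IH[OF Y(2) X(2)] by blast
      \<comment> \<open>The first half reads the middle letter, the second half the product of the outer two.\<close>
      let ?k = "(companion ?\<kappa>, e')" and ?l = "(klein_add ?\<kappa> (companion ?\<kappa>), False)"
      let ?Z = "?k # (?\<kappa>, e) # ?l # Z"
      have al: "alive ?\<kappa> (companion ?\<kappa>)" "\<not> alive ?\<kappa> ?\<kappa>" "alive ?\<kappa> (klein_add ?\<kappa> (companion ?\<kappa>))"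
        using companion[OF \<omega>[of 0]] by (auto simp: alive_def)
      have kl: "act \<omega>' ?k \<circ> (act \<omega>' ?l \<circ> g) = act \<omega>' (q, e') \<circ> g" for g
        using act_add[of \<omega>' ?k ?l, OF \<omega>'] companion(5)[OF \<omega>[of 0]] True
        by (simp add: letter_add_def comp_assoc[symmetric])
      have "word_map \<omega> ?Z = node (\<not> \<epsilon>) (flip \<circ> (act \<omega>' (q, e) \<circ> (flip \<circ> word_map \<omega>' X' \<circ> c')))
          (act \<omega>' ?k \<circ> (act \<omega>' ?l \<circ> (flip \<circ> (word_map \<omega>' Y' \<circ> c))))"
        by (simp only: word_map_simps Z(2) letter_step al True \<omega>'_def[symmetric] comp_assoc if_True if_False fst_conv not_not)
      also have "\<dots> = node (\<not> \<epsilon>) (flip \<circ> (word_map \<omega>' X \<circ> c')) (word_map \<omega>' Y \<circ> c)"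
        by (simp only: kl X Y word_map_simps comp_assoc)
      finally show ?thesis using Z(1) True by (intro exI[of _ ?Z]) simp
    qed
    thus ?thesis using c by blast
  next
    case False
    have "\<exists>Z. map fst Z = substitute ?\<kappa> (q # qs) \<and>
        word_map \<omega> Z = node \<epsilon> (flip \<circ> (word_map \<omega>' X \<circ> c)) (word_map \<omega>' Y \<circ> c')"
      if XY: "map fst X = q # qs" "map fst Y = q # qs" for X Y
    proof -
      obtain e X' where X: "X = (q, e) # X'" "map fst X' = qs" using XY(1) by (rule map_fst_ConsE)
      obtain e' Y' where Y: "Y = (q, e') # Y'" "map fst Y' = qs" using XY(2) by (rule map_fst_ConsE)
      obtain Z where Z: "map fst Z = substitute ?\<kappa> qs"
        "word_map \<omega> Z = node \<epsilon> (flip \<circ> (word_map \<omega>' X' \<circ> c)) (word_map \<omega>' Y' \<circ> c')"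
        using IH[OF X(2) Y(2)] by blast
      let ?Z = "(q, e') # (q, e) # Z"
      have al: "alive ?\<kappa> q" using False Cons.prems by (auto simp: alive_def)
      have "word_map \<omega> ?Z = node \<epsilon> (flip \<circ> (word_map \<omega>' X \<circ> c)) (word_map \<omega>' Y \<circ> c')"
        by (simp only: word_map_simps Z(2) letter_step al X(1) Y(1) \<omega>'_def[symmetric] comp_assoc if_True if_False fst_conv not_not)
      thus ?thesis using Z(1) False by (intro exI[of _ ?Z]) simp
    qed
    thus ?thesis using c by blast
  qed
qed

text \<open>The elements obtained from one word by choosing whether to switch the lamp at each letter.  This is
where the wreath product gains over the tree action alone: the number of variants is squared by
each substitution.\<close>

definition lamp_variants :: "(nat \<Rightarrow> klein) \<Rightarrow> klein list \<Rightarrow> (point \<Rightarrow> point) set" where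
  "lamp_variants \<omega> qs = word_map \<omega> ` {X. map fst X = qs}"

lemma finite_lamp_variants: "finite (lamp_variants \<omega> qs)"
proof -
  have "{X :: (klein \<times> bool) list. map fst X = qs} \<subseteq> {X. set X \<subseteq> UNIV \<and> length X \<le> length qs}"
    by auto
  moreover have "finite \<dots>" by (rule finite_lists_length_le) simp
  ultimately show ?thesis unfolding lamp_variants_def by (blast intro: finite_subset)
qed

lemma card_lamp_variants_substitute:
  assumes \<omega>: "\<And>i. \<omega> i \<noteq> kzero" and qs: "kzero \<notin> set qs"
  shows "(card (lamp_variants (\<lambda>i. \<omega> (Suc i)) qs))\<^sup>2 \<le> card (lamp_variants \<omega> (substitute (\<omega> 0) qs))"
proof -
  let ?L = "lamp_variants (\<lambda>i. \<omega> (Suc i)) qs"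
  obtain \<epsilon> c c' where c: "c \<circ> c = id" "c' \<circ> c' = id" and
    ex: "\<And>X Y. map fst X = qs \<Longrightarrow> map fst Y = qs \<Longrightarrow>
      (\<exists>Z. map fst Z = substitute (\<omega> 0) qs \<and>
        word_map \<omega> Z = node \<epsilon> (flip \<circ> (word_map (\<lambda>i. \<omega> (Suc i)) X \<circ> c)) (word_map (\<lambda>i. \<omega> (Suc i)) Y \<circ> c'))"
    using substitute_sections[of \<omega>, OF \<omega> qs] by blast
  define F where "F = (\<lambda>(g, h). node \<epsilon> (flip \<circ> (g \<circ> c)) (h \<circ> c'))"
  have "F ` (?L \<times> ?L) \<subseteq> lamp_variants \<omega> (substitute (\<omega> 0) qs)"
    using ex unfolding F_def lamp_variants_def by (fastforce simp: image_iff)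
  moreover have "inj_on F (?L \<times> ?L)"
  proof (rule inj_onI, clarify)
    fix g h g' h'
    assume "F (g, h) = F (g', h')"
    hence "flip \<circ> (g \<circ> c) = flip \<circ> (g' \<circ> c)" "h \<circ> c' = h' \<circ> c'" by (auto simp: F_def node_eq_iff)
    hence "flip \<circ> (flip \<circ> (g \<circ> c)) \<circ> c = flip \<circ> (flip \<circ> (g' \<circ> c)) \<circ> c" "h \<circ> c' \<circ> c' = h' \<circ> c' \<circ> c'"
      by simp_all
    moreover have "flip \<circ> (flip \<circ> (g \<circ> c)) \<circ> c = g" for g
      using c(1) by (metis comp_assoc comp_id flip_involution id_comp)
    moreover have "h \<circ> c' \<circ> c' = h" for h :: "point \<Rightarrow> point" using c(2) by (simp only: comp_assoc comp_id)
    ultimately show "g = g' \<and> h = h'" by simp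
  qed
  ultimately have "card (?L \<times> ?L) \<le> card (lamp_variants \<omega> (substitute (\<omega> 0) qs))"
    by (metis card_image card_mono finite_lamp_variants)
  thus ?thesis by (simp add: card_cartesian_product power2_eq_square)
qed

lemma card_lamp_variants_single: "2 \<le> card (lamp_variants \<omega> [q])"
proof -
  have "flip (flip y) = y" for y using flip_involution by (metis comp_apply id_apply)
  hence "word_map \<omega> [(q, e)] (flip (\<lambda>_. True, False)) = (\<lambda>_. True, e)" for e
    by (simp add: word_map_simps del: flip.simps)
  hence "word_map \<omega> [(q, True)] \<noteq> word_map \<omega> [(q, False)]" by (metis prod.inject)
  hence "card {word_map \<omega> [(q, True)], word_map \<omega> [(q, False)]} = 2" by simp
  moreover have "{word_map \<omega> [(q, True)], word_map \<omega> [(q, False)]} \<subseteq> lamp_variants \<omega> [q]"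
    unfolding lamp_variants_def by (auto intro!: image_eqI[of _ "word_map \<omega>"])
  ultimately show ?thesis using card_mono[OF finite_lamp_variants] by metis
qed

fun substitute_iter :: "(nat \<Rightarrow> klein) \<Rightarrow> nat \<Rightarrow> klein list \<Rightarrow> klein list" where
  "substitute_iter \<omega> 0 qs = qs"
| "substitute_iter \<omega> (Suc k) qs = substitute (\<omega> 0) (substitute_iter (\<lambda>i. \<omega> (Suc i)) k qs)"

lemma kzero_substitute_iter:
  assumes "\<And>i. \<omega> i \<noteq> kzero" "kzero \<notin> set qs"
  shows "kzero \<notin> set (substitute_iter \<omega> k qs)"
  using assms
proof (induction k arbitrary: \<omega>)
  case (Suc k)
  have *: "kzero \<notin> set (substitute \<kappa> qs)" if "kzero \<notin> set qs" "\<kappa> \<noteq> kzero" for \<kappa> qs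
    using that(1)
  proof (induction qs)
    case (Cons q qs)
    have "kzero \<noteq> companion \<kappa>" "kzero \<noteq> klein_add \<kappa> (companion \<kappa>)"
      using companion(1,3)[OF that(2)] by metis+
    with Cons that(2) show ?case by simp
  qed simp
  have "kzero \<notin> set (substitute_iter (\<lambda>i. \<omega> (Suc i)) k qs)" by (rule Suc.IH) (use Suc.prems in auto)
  from *[OF this Suc.prems(1)[of 0]] show ?case by simp
qed simp

lemma card_lamp_variants_iter:
  assumes "\<And>i. \<omega> i \<noteq> kzero" "q \<noteq> kzero"
  shows "2 ^ (2 ^ k) \<le> card (lamp_variants \<omega> (substitute_iter \<omega> k [q]))"
  using assms(1)
proof (induction k arbitrary: \<omega>)
  case 0
  show ?case using card_lamp_variants_single[of \<omega> q] by simp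
next
  case (Suc k)
  let ?c = "card (lamp_variants (\<lambda>i. \<omega> (Suc i)) (substitute_iter (\<lambda>i. \<omega> (Suc i)) k [q]))"
  have "2 ^ (2 ^ k) \<le> ?c" by (rule Suc.IH) (rule Suc.prems)
  hence "(2 ^ (2 ^ k))\<^sup>2 \<le> ?c\<^sup>2" by (rule power_mono) simp
  also have "\<dots> \<le> card (lamp_variants \<omega> (substitute_iter \<omega> (Suc k) [q]))"
    unfolding substitute_iter.simps
    by (intro card_lamp_variants_substitute kzero_substitute_iter) (use Suc.prems assms(2) in auto)
  finally show ?case by (simp add: power_mult[symmetric] mult.commute)
qed

text \<open>The substitution is dual to the push: it lengthens words exactly as the push increases weights.  This
is why the lower and the upper bound meet.\<close>

lemma weight_substitute_iter:
  assumes "\<And>i. \<omega> i \<noteq> kzero" "kzero \<notin> set qs"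
  shows "(\<Sum>q\<leftarrow>substitute_iter \<omega> k qs. W q) = (\<Sum>q\<leftarrow>qs. push_iter \<omega> W k q)"
  using assms(1)
proof (induction k arbitrary: \<omega> W)
  case (Suc k)
  have pq: "W (companion \<kappa>) + (W \<kappa> + W (klein_add \<kappa> (companion \<kappa>))) = mass W"
    if "\<kappa> \<noteq> kzero" for \<kappa>
    using that by (cases \<kappa> rule: klein_cases) (auto simp: companion_def klein_add_def mass_def)
  have *: "(\<Sum>q\<leftarrow>substitute \<kappa> qs. W q) = (\<Sum>q\<leftarrow>qs. push \<kappa> W q)"
    if "kzero \<notin> set qs" "\<kappa> \<noteq> kzero" for \<kappa> qs
    using that(1)
  proof (induction qs)
    case (Cons q qs)
    hence "q \<noteq> kzero" by auto
    thus ?case using Cons pq[OF that(2)] by (cases "q = \<kappa>") (simp_all add: push_def)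
  qed simp
  have "(\<Sum>q\<leftarrow>substitute_iter \<omega> (Suc k) qs. W q) =
      (\<Sum>q\<leftarrow>substitute_iter (\<lambda>i. \<omega> (Suc i)) k qs. push (\<omega> 0) W q)"
    unfolding substitute_iter.simps
    by (intro * kzero_substitute_iter) (use Suc.prems assms(2) in auto)
  also have "\<dots> = (\<Sum>q\<leftarrow>qs. push_iter \<omega> W (Suc k) q)"
    unfolding push_iter.simps by (rule Suc.IH) (rule Suc.prems)
  finally show ?case .
qed simp

lemma length_substitute_iter:
  assumes "\<And>i. \<omega> i \<noteq> kzero" "q \<noteq> kzero"
  shows "real (length (substitute_iter \<omega> k [q])) = push_iter \<omega> unit_weight k q"
proof -
  have "kzero \<notin> set qs \<Longrightarrow> (\<Sum>q\<leftarrow>qs. unit_weight q) = real (length qs)" for qs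
    by (induction qs) (auto simp: unit_weight_def)
  thus ?thesis
    using weight_substitute_iter[of \<omega> "[q]" unit_weight k, OF assms(1)] assms(2)
      kzero_substitute_iter[of \<omega> "[q]" k, OF assms(1)] by simp
qed

section \<open>Balls of the group and the two growth bounds\<close>

definition gens :: "(nat \<Rightarrow> klein) \<Rightarrow> (point \<Rightarrow> point) set" where
  "gens \<omega> = insert flip (range (act \<omega>))"

definition ball :: "(nat \<Rightarrow> klein) \<Rightarrow> real \<Rightarrow> (point \<Rightarrow> point) set" where
  "ball \<omega> R = {comp_list w | w. set w \<subseteq> gens \<omega> \<and> real (length w) \<le> R}"

lemma finite_gens: "finite (gens \<omega>)"
  by (simp add: gens_def)

lemma finite_ball_gens: "finite (ball \<omega> R)"
proof -
  have "ball \<omega> R \<subseteq> comp_list ` {w. set w \<subseteq> gens \<omega> \<and> length w \<le> nat \<lfloor>R\<rfloor>}"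
    by (auto simp: ball_def le_nat_floor)
  thus ?thesis by (rule finite_subset) (intro finite_imageI finite_lists_length_le finite_gens)
qed

text \<open>The lamp variants of the \<open>k\<close>-fold substitution of a single letter.  The factor 2 pays for the flips
between the letters.\<close>

lemma card_ball_lower:
  assumes \<omega>: "\<And>i. \<omega> i \<noteq> kzero" and q: "q \<noteq> kzero"
    and R: "2 * push_iter \<omega> unit_weight k q \<le> R"
  shows "2 ^ (2 ^ k) \<le> card (ball \<omega> R)"
proof -
  let ?qs = "substitute_iter \<omega> k [q]"
  have "lamp_variants \<omega> ?qs \<subseteq> ball \<omega> R"
  proof
    fix g assume "g \<in> lamp_variants \<omega> ?qs"
    then obtain X where X: "g = word_map \<omega> X" "map fst X = ?qs" by (auto simp: lamp_variants_def)
    let ?w = "concat (map (\<lambda>k. [act \<omega> k, flip]) X)"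
    have "length X = length ?qs" by (metis X(2) length_map)
    moreover have "length ?w = 2 * length X" by (induction X) auto
    ultimately have "real (length ?w) \<le> R"
      using R length_substitute_iter[of \<omega> q k, OF \<omega> q] by simp
    moreover have "set ?w \<subseteq> gens \<omega>" by (auto simp: gens_def)
    ultimately show "g \<in> ball \<omega> R" using X(1) unfolding ball_def word_map_def by blast
  qed
  hence "card (lamp_variants \<omega> ?qs) \<le> card (ball \<omega> R)" by (rule card_mono[OF finite_ball_gens])
  thus ?thesis using card_lamp_variants_iter[of \<omega> q k, OF \<omega> q] by linarith
qed

lemma ex_syllables:
  assumes \<omega>: "\<And>i. \<omega> i \<noteq> kzero" and "set w \<subseteq> gens \<omega>"
  shows "\<exists>x. eval \<omega> x = comp_list w \<and> weigh unit_weight x \<le> real (length w)"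
  using assms(2)
proof (induction w)
  case Nil
  thus ?case by (intro exI[of _ "((kzero, False), [])"])
      (simp add: eval_Nil act_zero weigh_simps unit_weight_def)
next
  case (Cons g w)
  then obtain x where x: "eval \<omega> x = comp_list w" "weigh unit_weight x \<le> real (length w)" by auto
  from Cons.prems consider "g = flip" | k where "g = act \<omega> k" by (auto simp: gens_def)
  thus ?case
  proof cases
    case 1
    have "eval \<omega> (mul_flip x) = comp_list (g # w)" by (simp only: eval_mul_flip x(1) 1 comp_list_simps)
    moreover have "weigh unit_weight (mul_flip x) \<le> real (length (g # w))"
      using x(2) by (simp add: weigh_simps unit_weight_def)
    ultimately show ?thesis by blast
  next
    case 2
    have sub: "subadditive unit_weight"
      unfolding subadditive_def by (auto simp: unit_weight_def klein_add_def)
    have "eval \<omega> (mul_letter k x) = comp_list (g # w)"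
      by (simp only: eval_mul_letter[of \<omega>, OF \<omega>] x(1) 2 comp_list_simps)
    moreover have "weigh unit_weight (mul_letter k x) \<le> real (length (g # w))"
      using x(2) weigh_mul_letter[OF sub, of k x] by (simp add: unit_weight_def split: if_splits)
    ultimately show ?thesis by blast
  qed
qed

lemma card_tokens: "card (UNIV :: token set) = 11"
  by (simp add: card_UNIV_bool)

lemma card_short_lists:
  fixes A :: "'a set"
  assumes "finite A" "2 \<le> card A"
  shows "card {xs. set xs \<subseteq> A \<and> length xs \<le> n} \<le> card A ^ (n + 1)"
proof -
  have "(\<Sum>i\<le>n. card A ^ i) \<le> card A ^ (n + 1)"
  proof (induction n)
    case 0
    thus ?case using assms(2) by simp
  next
    case (Suc n)
    have "(\<Sum>i\<le>Suc n. card A ^ i) \<le> 2 * card A ^ (n + 1)" using Suc by simp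
    also have "\<dots> \<le> card A * card A ^ (n + 1)" using assms(2) by (rule mult_right_mono) simp
    finally show ?case by simp
  qed
  thus ?thesis using card_lists_length_le[OF assms(1)] by simp
qed

text \<open>If the pushed weights are comparable to their mass, a word of length at most \<open>mass V\<close> has a portrait
whose size is proportional to its number of leaves: with \<open>c = mass V / 20\<close>, the bound of
\<open>ex_short_portrait\<close> is at most \<open>(6 + 2 * 20) * 2 ^ k\<close>.  The base 11 is the number of tokens.\<close>

lemma card_ball_upper:
  assumes \<omega>: "\<And>i. \<omega> i \<noteq> kzero" and V: "V = push_iter \<omega> unit_weight k"
    and pos: "mass V > 0" and balanced: "\<And>q. q \<noteq> kzero \<Longrightarrow> mass V \<le> 20 * V q"
    and R: "R \<le> mass V"
  shows "card (ball \<omega> R) \<le> 11 ^ (47 * 2 ^ k)"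
proof -
  let ?N = "46 * 2 ^ k"
  let ?P = "{p. length (serialize p) \<le> ?N}"
  have fin: "finite {xs :: token list. set xs \<subseteq> UNIV \<and> length xs \<le> ?N}"
    by (rule finite_lists_length_le) simp
  have sub: "serialize ` ?P \<subseteq> {xs. set xs \<subseteq> UNIV \<and> length xs \<le> ?N}" by auto
  have "card (serialize ` ?P) \<le> 11 ^ (?N + 1)"
    using card_mono[OF fin sub] card_short_lists[of "UNIV :: token set" ?N]
    unfolding card_tokens by simp
  moreover have "finite (serialize ` ?P)" by (rule finite_subset[OF sub fin])
  moreover have inj: "inj_on serialize ?P" by (rule inj_on_subset[OF inj_serialize]) simp
  ultimately have cardP: "card ?P \<le> 11 ^ (?N + 1)" and finP: "finite ?P"
    by (simp_all add: card_image finite_image_iff)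
  have "ball \<omega> R \<subseteq> realize \<omega> ` ?P"
  proof
    fix g assume "g \<in> ball \<omega> R"
    then obtain w where w: "g = comp_list w" "set w \<subseteq> gens \<omega>" "real (length w) \<le> R"
      by (auto simp: ball_def)
    obtain x where x: "eval \<omega> x = g" "weigh unit_weight x \<le> R"
      using ex_syllables[of \<omega>, OF \<omega> w(2)] w by force
    have c: "0 < mass V / 20" "\<And>q. q \<noteq> kzero \<Longrightarrow> mass V / 20 \<le> V q"
      using pos balanced by (auto simp: field_simps)
    \<comment> \<open>The upper bound on the growth is at most \<open>2 powr (4 * 47 * 8 ^ (i + 1))\<close>, and \<open>4 * 47 * 8 = 1504\<close>.\<close>
    obtain p where p: "realize \<omega> p = g" "real (length (serialize p)) \<le>
        6 * 2 ^ k - 1 + 2 ^ k * (weigh unit_weight x + mass V - mass unit_weight) / (mass V / 20)"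
      using ex_short_portrait[of unit_weight \<omega> V k "mass V / 20" x, OF triangular_unit_weight \<omega> V c] x(1) by auto
    have "weigh unit_weight x + mass V - mass unit_weight \<le> 2 * mass V"
      using x(2) R by (simp add: mass_def unit_weight_def)
    hence "2 ^ k * (weigh unit_weight x + mass V - mass unit_weight) / (mass V / 20)
        \<le> 2 ^ k * (2 * mass V) / (mass V / 20)"
      using pos by (intro divide_right_mono mult_left_mono) auto
    also have "\<dots> = 40 * 2 ^ k" using pos by (simp add: field_simps)
    finally have "real (length (serialize p)) \<le> real ?N" using p(2) by simp
    hence "p \<in> ?P" by (simp only: of_nat_le_iff mem_Collect_eq)
    thus "g \<in> realize \<omega> ` ?P" using p(1) by blast
  qed
  hence "card (ball \<omega> R) \<le> card ?P" by (rule surj_card_le[OF finP])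
  also have "\<dots> \<le> 11 ^ (?N + 1)" by (rule cardP)
  also have "\<dots> \<le> 11 ^ (47 * 2 ^ k)" by (rule power_increasing) auto
  finally show ?thesis .
qed

section \<open>Spines built from cyclic and constant blocks\<close>

text \<open>Spines are built from blocks of three levels.  In a cyclic block the three letters are killed one
after the other, in a constant block \<open>b0\<close> is killed three times.  A cyclic block is used as long as
the value of \<open>H\<close> at the mass lags behind \<open>8 ^ j\<close>, the size \<open>2 ^ (3 * j)\<close> of the level reached.\<close>

abbreviation "b0 \<equiv> (True, False)"
abbreviation "b1 \<equiv> (False, True)"
abbreviation "b2 \<equiv> (True, True)"

lemma push_iter_right: "push_iter \<omega> W (Suc k) = push (\<omega> k) (push_iter \<omega> W k)"
proof (induction k arbitrary: \<omega> W)
  case (Suc k)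
  show ?case using Suc[of "\<lambda>i. \<omega> (Suc i)" "push (\<omega> 0) W"] by simp
qed simp

definition cyclic_block :: "weight \<Rightarrow> weight" where
  "cyclic_block V = push b2 (push b1 (push b0 V))"

definition constant_block :: "weight \<Rightarrow> weight" where
  "constant_block V = push b0 (push b0 (push b0 V))"

fun weight_seq :: "(real \<Rightarrow> real) \<Rightarrow> nat \<Rightarrow> weight" where
  "weight_seq H 0 = unit_weight"
| "weight_seq H (Suc j) = (if H (mass (weight_seq H j)) < 8 ^ j
     then cyclic_block (weight_seq H j) else constant_block (weight_seq H j))"

definition spine :: "(real \<Rightarrow> real) \<Rightarrow> nat \<Rightarrow> klein" where
  "spine H n = (if H (mass (weight_seq H (n div 3))) < 8 ^ (n div 3)
     then [b0, b1, b2] ! (n mod 3) else b0)"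

lemma spine_nonzero: "spine H n \<noteq> kzero"
proof -
  have "n mod 3 = 0 \<or> n mod 3 = 1 \<or> n mod 3 = 2" by linarith
  thus ?thesis by (auto simp: spine_def)
qed

lemma push_iter_spine: "push_iter (spine H) unit_weight (3 * j) = weight_seq H j"
proof (induction j)
  case (Suc j)
  have d: "(3 * j) div 3 = j" "Suc (3 * j) div 3 = j" "Suc (Suc (3 * j)) div 3 = j"
    "(3 * j) mod 3 = 0" "Suc (3 * j) mod 3 = 1" "Suc (Suc (3 * j)) mod 3 = 2"
    by presburger+
  have "3 * Suc j = Suc (Suc (Suc (3 * j)))" by simp
  hence "push_iter (spine H) unit_weight (3 * Suc j) =
      push (spine H (Suc (Suc (3 * j)))) (push (spine H (Suc (3 * j))) (push (spine H (3 * j))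
        (weight_seq H j)))"
    by (simp only: push_iter_right Suc.IH)
  moreover let ?c = "H (mass (weight_seq H j)) < 8 ^ j"
  have "spine H (3 * j) = b0" "spine H (Suc (3 * j)) = (if ?c then b1 else b0)"
    "spine H (Suc (Suc (3 * j))) = (if ?c then b2 else b0)"
    by (simp_all only: spine_def d) simp_all
  ultimately show ?case by (simp add: cyclic_block_def constant_block_def)
qed simp

lemma cyclic_block_simps:
  "cyclic_block V b0 = 4 * mass V"
  "cyclic_block V b1 = 2 * mass V + 4 * (V b1 + V b2)"
  "cyclic_block V b2 = 3 * mass V + 2 * V b1 + 6 * V b2"
  by (simp_all add: cyclic_block_def push_def mass_def)

lemma constant_block_simps:
  "constant_block V b0 = V b0 + 7 * (V b1 + V b2)"
  "constant_block V b1 = 8 * V b1"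
  "constant_block V b2 = 8 * V b2"
  by (simp_all add: constant_block_def push_def mass_def)

text \<open>Weights stay comparable to their mass along every sequence of blocks.  The condition singles out
\<open>b1\<close> and \<open>b2\<close> because a constant block multiplies their weights by exactly 8 and keeps the weight
of \<open>b0\<close> at least comparable to their sum; a cyclic block creates balance from any triangular weight.\<close>

definition balanced :: "weight \<Rightarrow> bool" where
  "balanced V \<longleftrightarrow> triangular V \<and> 0 < mass V \<and> (\<forall>q. q \<noteq> kzero \<longrightarrow> V b1 + V b2 \<le> 10 * V q)"

lemma mass_le_balanced:
  assumes "balanced V" "q \<noteq> kzero"
  shows "mass V \<le> 20 * V q"
proof -
  have "triangular V" "V b1 + V b2 \<le> 10 * V q" using assms unfolding balanced_def by blast+
  moreover from this(1) have "2 * V b0 \<le> mass V" by (rule triangularD)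
  ultimately show ?thesis by (simp add: mass_def)
qed

lemma triangular_blocks:
  assumes "triangular V"
  shows "triangular (cyclic_block V)" "triangular (constant_block V)"
    "8 * mass V \<le> mass (cyclic_block V)" "8 * mass V \<le> mass (constant_block V)"
    "mass (cyclic_block V) \<le> 27 * mass V" "mass (constant_block V) \<le> 27 * mass V"
proof -
  have nz: "b0 \<noteq> kzero" "b1 \<noteq> kzero" "b2 \<noteq> kzero" by auto
  note t = triangular_push
  note p0 = t[OF assms nz(1)]
  note p1 = t[OF p0(1) nz(2)] and c1 = t[OF p0(1) nz(1)]
  note p2 = t[OF p1(1) nz(3)] and c2 = t[OF c1(1) nz(1)]
  show "triangular (cyclic_block V)" "triangular (constant_block V)"
    using p2 c2 by (simp_all add: cyclic_block_def constant_block_def)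
  show "8 * mass V \<le> mass (cyclic_block V)" "8 * mass V \<le> mass (constant_block V)"
    "mass (cyclic_block V) \<le> 27 * mass V" "mass (constant_block V) \<le> 27 * mass V"
    unfolding cyclic_block_def constant_block_def using p0 p1 p2 c1 c2 by linarith+
qed

lemma balanced_blocks:
  assumes "balanced V"
  shows "balanced (cyclic_block V)" "balanced (constant_block V)"
proof -
  have tri: "triangular V" and pos: "0 < mass V" using assms unfolding balanced_def by blast+
  have V: "0 \<le> V b0" "0 \<le> V b1" "0 \<le> V b2" using triangularD(1)[OF tri] by auto
  have bal: "V b1 + V b2 \<le> 10 * V b0" "V b1 + V b2 \<le> 10 * V b1" "V b1 + V b2 \<le> 10 * V b2"
    using assms unfolding balanced_def by simp_all
  note T = triangular_blocks[OF tri]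
  have "cyclic_block V b1 + cyclic_block V b2 \<le> 10 * cyclic_block V q" if "q \<noteq> kzero" for q
    using V that by (cases q rule: klein_cases) (auto simp: cyclic_block_simps mass_def)
  thus "balanced (cyclic_block V)" using T pos by (auto simp: balanced_def)
  have "constant_block V b1 + constant_block V b2 \<le> 10 * constant_block V q" if "q \<noteq> kzero" for q
    using V bal that by (cases q rule: klein_cases) (auto simp: constant_block_simps)
  thus "balanced (constant_block V)" using T pos by (auto simp: balanced_def)
qed

lemma balanced_weight_seq: "balanced (weight_seq H j)"
proof (induction j)
  case 0
  have "0 < mass unit_weight" by (simp add: mass_def unit_weight_def)
  moreover have "\<forall>q. q \<noteq> kzero \<longrightarrow> unit_weight b1 + unit_weight b2 \<le> 10 * unit_weight q"
    by (simp add: unit_weight_def)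
  ultimately show ?case using triangular_unit_weight unfolding balanced_def weight_seq.simps by blast
next
  case (Suc j)
  thus ?case using balanced_blocks by simp
qed

lemma mass_weight_seq_Suc:
  "8 * mass (weight_seq H j) \<le> mass (weight_seq H (Suc j))"
  "mass (weight_seq H (Suc j)) \<le> 27 * mass (weight_seq H j)"
  using balanced_weight_seq[of H j] by (auto simp: balanced_def triangular_blocks)

lemma mass_weight_seq_ge: "8 ^ j \<le> mass (weight_seq H j)"
proof (induction j)
  case 0
  show ?case by (simp add: mass_def unit_weight_def)
next
  case (Suc j)
  thus ?case using mass_weight_seq_Suc(1)[of H j] by simp
qed

lemma eta_eq: "eta_plus ^ 3 = eta_plus\<^sup>2 + 2 * eta_plus + 4"
  using eta_plus(2) by simp

lemma eta_bounds: "2 \<le> eta_plus" "eta_plus \<le> 3"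
proof -
  have *: "eta_plus * (eta_plus + 1) * (eta_plus - 2) = 4"
    using eta_eq by (simp add: algebra_simps power2_eq_square power3_eq_cube)
  have p: "0 < eta_plus * (eta_plus + 1)" using eta_plus(1) by simp
  show 2: "2 \<le> eta_plus"
  proof (rule ccontr)
    assume "\<not> 2 \<le> eta_plus"
    hence "eta_plus * (eta_plus + 1) * (eta_plus - 2) < 0" using p by (intro mult_pos_neg) auto
    thus False using * by simp
  qed
  show "eta_plus \<le> 3"
  proof (rule ccontr)
    assume "\<not> eta_plus \<le> 3"
    hence "12 * 1 \<le> eta_plus * (eta_plus + 1) * (eta_plus - 2)"
      using 2 mult_mono[of 3 eta_plus 4 "eta_plus + 1"] by (intro mult_mono) auto
    thus False using * by simp
  qed
qed

text \<open>The left Perron eigenvector of a cyclic block.  A push followed by the cyclic renaming of the letters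
has the characteristic polynomial \<open>X ^ 3 - X ^ 2 - 2 * X - 4\<close>, and this functional is its
eigenvector for the root \<open>eta_plus\<close>.\<close>

definition perron :: "weight \<Rightarrow> real" where
  "perron V = V b0 + (eta_plus\<^sup>2 - eta_plus) / 2 * V b1 + eta_plus * V b2"

lemma perron_cyclic_block: "perron (cyclic_block V) = eta_plus ^ 3 * perron V"
proof -
  let ?e = eta_plus
  have e4: "?e ^ 4 = 3 * ?e\<^sup>2 + 6 * ?e + 4" and e5: "?e ^ 5 = 9 * ?e\<^sup>2 + 10 * ?e + 12"
  proof -
    have "?e ^ 4 = ?e * ?e ^ 3" by (simp add: power_def numeral_eq_Suc)
    also have "\<dots> = ?e ^ 3 + 2 * ?e\<^sup>2 + 4 * ?e"
      by (subst eta_eq) (simp add: power2_eq_square power3_eq_cube algebra_simps)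
    finally show 4: "?e ^ 4 = 3 * ?e\<^sup>2 + 6 * ?e + 4" by (simp add: eta_eq)
    have "?e ^ 5 = ?e * ?e ^ 4" by (simp add: numeral_eq_Suc)
    also have "\<dots> = 3 * ?e ^ 3 + 6 * ?e\<^sup>2 + 4 * ?e"
      unfolding 4 by (simp add: power2_eq_square power3_eq_cube algebra_simps)
    finally show "?e ^ 5 = 9 * ?e\<^sup>2 + 10 * ?e + 12" by (simp add: eta_eq)
  qed
  have "eta_plus ^ 3 * perron V =
      ?e ^ 3 * V b0 + (?e ^ 5 - ?e ^ 4) / 2 * V b1 + ?e ^ 4 * V b2"
    by (simp add: perron_def numeral_eq_Suc algebra_simps diff_divide_distrib)
  also have "\<dots> = perron (cyclic_block V)"
    unfolding e4 e5 eta_eq by (simp add: perron_def cyclic_block_simps mass_def field_simps)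
  finally show ?thesis ..
qed

lemma perron_bounds:
  assumes "triangular V"
  shows "mass V \<le> perron V" "perron V \<le> 3 * mass V"
proof -
  have V: "0 \<le> V b0" "0 \<le> V b1" "0 \<le> V b2" using triangularD(1)[OF assms] by auto
  define r where "r = (eta_plus\<^sup>2 - eta_plus) / 2"
  have "2 * 1 \<le> eta_plus * (eta_plus - 1)" "eta_plus * (eta_plus - 1) \<le> 3 * 2"
    by (rule mult_mono; use eta_bounds in simp)+
  hence r: "1 \<le> r" "r \<le> 3" by (simp_all add: r_def power2_eq_square algebra_simps)
  have "1 * V b1 \<le> r * V b1" "r * V b1 \<le> 3 * V b1"
    "1 * V b2 \<le> eta_plus * V b2" "eta_plus * V b2 \<le> 3 * V b2"
    by (rule mult_right_mono; use V r eta_bounds in simp)+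
  thus "mass V \<le> perron V" "perron V \<le> 3 * mass V"
    using V by (simp_all add: perron_def mass_def r_def[symmetric])
qed

lemma growth_of_weight_seq:
  "\<exists>(G :: nat monoid) S. group G \<and> finite S \<and> semigroup_generates G S \<and>
    (\<forall>j R. R \<le> mass (weight_seq H j) \<longrightarrow> growth G S R \<le> 11 ^ (47 * 8 ^ j)) \<and>
    (\<forall>j R. 2 * mass (weight_seq H j) \<le> R \<longrightarrow> 2 ^ (8 ^ j) \<le> growth G S R)"
proof -
  let ?\<omega> = "spine H"
  have inv: "g \<circ> g = id" if "g \<in> gens ?\<omega>" for g
    using that act_involution[of ?\<omega>, OF spine_nonzero] flip_involution by (auto simp: gens_def)
  obtain G :: "nat monoid" and S where G: "group G" "finite S" "semigroup_generates G S"
    and gr: "\<And>R. growth G S R = real (card (ball ?\<omega> R))"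
    using involutions_generate_group[OF finite_gens _ inv] unfolding ball_def gens_def by blast
  have pow: "(2 :: nat) ^ (3 * j) = 8 ^ j" for j by (simp add: power_mult)
  have "growth G S R \<le> 11 ^ (47 * 8 ^ j)" if "R \<le> mass (weight_seq H j)" for j R
  proof -
    have "card (ball ?\<omega> R) \<le> 11 ^ (47 * 2 ^ (3 * j))"
      by (rule card_ball_upper[of ?\<omega>, OF spine_nonzero push_iter_spine[symmetric]])
        (use that balanced_weight_seq[of H j] mass_le_balanced in \<open>auto simp: balanced_def\<close>)
    hence "real (card (ball ?\<omega> R)) \<le> real (11 ^ (47 * 2 ^ (3 * j)))" by (simp only: of_nat_le_iff)
    thus ?thesis by (simp add: gr pow)
  qed
  moreover have "2 ^ (8 ^ j) \<le> growth G S R" if R: "2 * mass (weight_seq H j) \<le> R" for j R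
  proof -
    have nn: "0 \<le> weight_seq H j q" for q
      using balanced_weight_seq[of H j] triangularD(1) by (auto simp: balanced_def)
    have "weight_seq H j b0 \<le> mass (weight_seq H j)"
      using nn[of b1] nn[of b2] by (simp add: mass_def)
    hence "2 ^ (2 ^ (3 * j)) \<le> card (ball ?\<omega> R)"
      using R by (intro card_ball_lower[of ?\<omega> b0, OF spine_nonzero]) (auto simp: push_iter_spine)
    hence "real (2 ^ (2 ^ (3 * j))) \<le> real (card (ball ?\<omega> R))" by (simp only: of_nat_le_iff)
    thus ?thesis by (simp add: gr pow)
  qed
  ultimately show ?thesis using G by blast
qed

section \<open>Choosing the spine for a prescribed growth\<close>

lemma unroll_doubling:
  fixes F :: "real \<Rightarrow> real"
  assumes "0 \<le> a" "\<And>R. a \<le> R \<Longrightarrow> F (2 * R) \<le> 2 * F R" "a \<le> R"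
  shows "F (2 ^ n * R) \<le> 2 ^ n * F R"
proof (induction n)
  case (Suc n)
  have "1 * a \<le> 2 ^ n * R" using assms(1,3) by (intro mult_mono) auto
  hence "F (2 * (2 ^ n * R)) \<le> 2 * F (2 ^ n * R)" using assms(2) by simp
  thus ?case using Suc by (simp add: mult.assoc)
qed simp

lemma unroll_eta:
  fixes F :: "real \<Rightarrow> real"
  assumes "0 \<le> a" "\<And>R. a \<le> R \<Longrightarrow> 2 * F R \<le> F (eta_plus * R)" "a \<le> R"
  shows "2 ^ n * F R \<le> F (eta_plus ^ n * R)"
proof (induction n)
  case (Suc n)
  have "1 * a \<le> eta_plus ^ n * R"
    using assms(1,3) eta_bounds by (intro mult_mono one_le_power) auto
  hence "2 * F (eta_plus ^ n * R) \<le> F (eta_plus * (eta_plus ^ n * R))" using assms(2) by simp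
  thus ?case using Suc by (simp add: mult.assoc)
qed simp

text \<open>The logarithm of the prescribed function after normalization.  The
argument needed to double its value lies between what a constant block provides, a factor 2 for each
level, and what a cyclic block provides, a factor \<open>eta_plus\<close> for each level.\<close>

locale coarse_scale =
  fixes H :: "real \<Rightarrow> real" and C :: real
  assumes doubling: "1 \<le> R \<Longrightarrow> H (2 * R) \<le> 2 * H R"
    and eta: "1 \<le> R \<Longrightarrow> 2 * H R \<le> H (eta_plus * R)"
    and C: "1 \<le> C"
    and coarse: "1 \<le> R \<Longrightarrow> R \<le> S \<Longrightarrow> H R \<le> H (C * S)"
    and start: "H 3 = 1"
begin

abbreviation "V \<equiv> weight_seq H"
abbreviation "s j \<equiv> mass (V j)"

lemma s_0: "s 0 = 3"
  by (simp add: mass_def unit_weight_def)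

lemma s_ge_1: "1 \<le> s j"
  using mass_weight_seq_ge[of j H] one_le_power[of "8::real" j] by linarith

lemma triangular_V: "triangular (V j)"
  using balanced_weight_seq[of H j] unfolding balanced_def by blast

text \<open>The masses do not run ahead of \<open>H\<close>: at the last index \<open>i\<close> where a cyclic block was chosen, or else
at the beginning, \<open>H\<close> was small, and only constant blocks follow.  These multiply the sum of the weights of
\<open>b1\<close> and \<open>b2\<close> by exactly 8, so no error accumulates however long the run is.  The factor 27 covers the
one cyclic block at \<open>i\<close>.\<close>

lemma slow_invariant:
  "\<exists>i n. j = i + n \<and> H (s i) \<le> 8 ^ i \<and> V j b1 + V j b2 \<le> 27 * 8 ^ n * s i"
proof (induction j)
  case 0
  have "V 0 b1 + V 0 b2 \<le> 27 * 8 ^ 0 * s 0" by (simp add: mass_def unit_weight_def)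
  moreover have "H (s 0) \<le> 8 ^ 0" unfolding s_0 using start by simp
  ultimately show ?case by (intro exI[of _ 0]) simp
next
  case (Suc j)
  show ?case
  proof (cases "H (s j) < 8 ^ j")
    case True
    have "0 \<le> V (Suc j) b0" using triangularD(1)[OF triangular_V] by blast
    hence "V (Suc j) b1 + V (Suc j) b2 \<le> s (Suc j)" unfolding mass_def by linarith
    also have "\<dots> \<le> 27 * 8 ^ 1 * s j" using mass_weight_seq_Suc(2)[of H j] s_ge_1[of j] by (simp del: weight_seq.simps)
    finally show ?thesis using True
      by (intro exI[of _ j] exI[of _ 1]) (simp del: weight_seq.simps)
  next
    case False
    obtain i n where in_: "j = i + n" "H (s i) \<le> 8 ^ i" "V j b1 + V j b2 \<le> 27 * 8 ^ n * s i"
      using Suc by blast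
    have "V (Suc j) b1 + V (Suc j) b2 = 8 * (V j b1 + V j b2)"
      using False by (simp add: constant_block_simps)
    also have "\<dots> \<le> 8 * (27 * 8 ^ n * s i)" using in_(3) by (rule mult_left_mono) simp
    also have "\<dots> = 27 * 8 ^ Suc n * s i" by simp
    finally show ?thesis using in_(1,2)
      by (intro exI[of _ i] exI[of _ "Suc n"]) (simp del: weight_seq.simps)
  qed
qed

text \<open>The counterpart of \<open>slow_invariant\<close> for runs of cyclic blocks, with the functional \<open>perron\<close>, which
these blocks multiply by exactly \<open>eta_plus ^ 3\<close>.  The factor 27 bounds \<open>eta_plus ^ 3\<close> and covers the
constant block at \<open>i\<close>.\<close>

lemma fast_invariant:
  "\<exists>i n. j = i + n \<and> 8 ^ i \<le> H (s i) \<and> eta_plus ^ (3 * n) * s i \<le> 27 * perron (V j)"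
proof (induction j)
  case 0
  have "s 0 \<le> perron (V 0)" by (rule perron_bounds[OF triangular_V])
  hence "eta_plus ^ (3 * 0) * s 0 \<le> 27 * perron (V 0)" using s_ge_1[of 0] by simp
  moreover have "8 ^ 0 \<le> H (s 0)" unfolding s_0 using start by simp
  ultimately show ?case by (intro exI[of _ 0]) simp
next
  case (Suc j)
  show ?case
  proof (cases "H (s j) < 8 ^ j")
    case True
    obtain i n where in_: "j = i + n" "8 ^ i \<le> H (s i)"
      "eta_plus ^ (3 * n) * s i \<le> 27 * perron (V j)"
      using Suc by blast
    have "eta_plus ^ (3 * Suc n) * s i = eta_plus ^ 3 * (eta_plus ^ (3 * n) * s i)"
      by (simp add: power_add)
    also have "\<dots> \<le> eta_plus ^ 3 * (27 * perron (V j))"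
      using in_(3) eta_bounds by (intro mult_left_mono) auto
    also have "\<dots> = 27 * perron (V (Suc j))" using True by (simp add: perron_cyclic_block)
    finally show ?thesis using in_(1,2)
      by (intro exI[of _ i] exI[of _ "Suc n"]) (simp del: weight_seq.simps)
  next
    case False
    have "eta_plus ^ 3 \<le> 3 ^ 3" using eta_bounds by (intro power_mono) auto
    hence "eta_plus ^ (3 * 1) * s j \<le> 27 * s j" using s_ge_1[of j] by (intro mult_right_mono) auto
    also have "\<dots> \<le> 27 * s (Suc j)" using mass_weight_seq_Suc(1)[of H j] s_ge_1[of j] by linarith
    also have "\<dots> \<le> 27 * perron (V (Suc j))" using perron_bounds(1)[OF triangular_V, of "Suc j"] by linarith
    finally show ?thesis using False
      by (intro exI[of _ j] exI[of _ 1]) (simp del: weight_seq.simps)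
  qed
qed

text \<open>Follow \<open>H\<close> from the index \<open>i\<close> of \<open>slow_invariant\<close>, by doubling the argument.\<close>

lemma H_weight_seq_le: "\<exists>m. \<forall>j. H (s j) \<le> 2 ^ m * 8 ^ j"
proof -
  obtain m where m: "54 * C < 2 ^ m" using real_arch_pow[of 2 "54 * C"] by auto
  have "H (s j) \<le> 2 ^ m * 8 ^ j" for j
  proof -
    obtain i n where in_: "j = i + n" "H (s i) \<le> 8 ^ i" "V j b1 + V j b2 \<le> 27 * 8 ^ n * s i"
      using slow_invariant by blast
    have "s j \<le> 2 * (V j b1 + V j b2)"
      using triangularD(2)[OF triangular_V, of j b0] by (simp add: mass_def)
    also have "\<dots> \<le> 54 * 8 ^ n * s i" using in_(3) by simp
    also have "\<dots> \<le> 2 ^ m / C * 8 ^ n * s i"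
      using m C s_ge_1[of i] by (intro mult_right_mono) (auto simp: field_simps)
    finally have "H (s j) \<le> H (C * (2 ^ m / C * 8 ^ n * s i))" using coarse s_ge_1 by blast
    also have "C * (2 ^ m / C * 8 ^ n * s i) = 2 ^ (m + 3 * n) * s i"
      using C by (simp add: power_add power_mult)
    also have "H \<dots> \<le> 2 ^ (m + 3 * n) * H (s i)" by (rule unroll_doubling[of 1 H, OF _ doubling s_ge_1]) simp
    also have "\<dots> \<le> 2 ^ (m + 3 * n) * 8 ^ i" using in_(2) by simp
    also have "\<dots> = 2 ^ m * 8 ^ j" by (simp add: in_(1) power_add power_mult)
    finally show ?thesis .
  qed
  thus ?thesis by blast
qed

text \<open>Follow \<open>H\<close> from the index \<open>i\<close> of \<open>fast_invariant\<close>, by multiplying the argument by \<open>eta_plus\<close>.\<close>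

lemma H_weight_seq_ge: "8 ^ j \<le> H (81 * C * s j)"
proof -
  obtain i n where in_: "j = i + n" "8 ^ i \<le> H (s i)"
      "eta_plus ^ (3 * n) * s i \<le> 27 * perron (V j)"
    using fast_invariant by blast
  have one: "1 \<le> eta_plus ^ (3 * n) * s i"
    using mult_mono[of 1 "eta_plus ^ (3 * n)" 1 "s i"] s_ge_1[of i] eta_bounds
    by (simp add: one_le_power)
  have "(8 :: real) ^ j = 2 ^ (3 * n) * 8 ^ i" by (simp add: in_(1) power_add power_mult)
  also have "\<dots> \<le> 2 ^ (3 * n) * H (s i)" using in_(2) by simp
  also have "\<dots> \<le> H (eta_plus ^ (3 * n) * s i)" by (rule unroll_eta[of 1 H, OF _ eta s_ge_1]) simp
  also have "\<dots> \<le> H (C * (81 * s j))"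
  proof (rule coarse[OF one])
    show "eta_plus ^ (3 * n) * s i \<le> 81 * s j"
      using in_(3) perron_bounds(2)[OF triangular_V[of j]] by linarith
  qed
  finally show ?thesis by (simp add: mult_ac)
qed

end

lemma ex_trivial_group:
  "\<exists>(G :: nat monoid) S. group G \<and> finite S \<and> semigroup_generates G S \<and>
    (\<forall>R\<ge>0. growth G S R = 1)"
proof -
  obtain G :: "nat monoid" and S where G: "group G" "finite S" "semigroup_generates G S"
    and gr: "\<And>R. growth G S R =
      real (card {comp_list w | w. set w \<subseteq> {id :: unit \<Rightarrow> unit} \<and> real (length w) \<le> R})"
    using involutions_generate_group[of "{id :: unit \<Rightarrow> unit}"] by auto
  have "{comp_list w | w. set w \<subseteq> {id :: unit \<Rightarrow> unit} \<and> real (length w) \<le> R} = {id}"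
    if "0 \<le> R" for R
    using that by (auto simp: fun_eq_iff intro!: exI[of _ "[]"])
  hence "growth G S R = 1" if "0 \<le> R" for R using that gr[of R] by simp
  thus ?thesis using G by blast
qed

theorem theorem1:
  fixes f :: "real \<Rightarrow> real"
  assumes "\<And>R. R \<ge> 0 \<Longrightarrow> f R \<ge> 0"
    and "\<forall>\<^sub>F R in at_top. f R > 0"
    and "coarsely_mono f"
    and "\<forall>\<^sub>F R in at_top. f (2 * R) \<le> (f R)\<^sup>2 \<and> (f R)\<^sup>2 \<le> f (eta_plus * R)"
  shows "\<exists>(G :: nat monoid) S. group G \<and> finite S \<and> semigroup_generates G S \<and> growth G S \<sim>\<^sub>g f"
proof -
  obtain C0 where C0: "C0 > 0" "\<forall>\<^sub>F R in at_top. \<forall>S\<ge>R. f R \<le> f (C0 * S)"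
    using assms(3) unfolding coarsely_mono_def by blast
  have "\<forall>\<^sub>F R in at_top. 1 \<le> R \<and> f R > 0 \<and> (\<forall>S\<ge>R. f R \<le> f (C0 * S)) \<and>
      f (2 * R) \<le> (f R)\<^sup>2 \<and> (f R)\<^sup>2 \<le> f (eta_plus * R)"
    by (intro eventually_conj eventually_ge_at_top assms(2,4) C0(2))
  then obtain N where N: "\<And>R. N \<le> R \<Longrightarrow> 1 \<le> R \<and> f R > 0 \<and> (\<forall>S\<ge>R. f R \<le> f (C0 * S)) \<and>
      f (2 * R) \<le> (f R)\<^sup>2 \<and> (f R)\<^sup>2 \<le> f (eta_plus * R)"
    unfolding eventually_at_top_linorder by blast
  have N1: "1 \<le> N" using N[of N] by simp
  define F where "F R = log 2 (f R)" for R
  define C where "C = max 1 C0"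
  have C: "1 \<le> C" "C0 \<le> C" by (auto simp: C_def)
  have f_F: "f R = 2 powr F R" if "N \<le> R" for R using N[OF that] by (simp add: F_def)
  have F_mono: "F R \<le> F R'" if "N \<le> R" "N \<le> R'" "f R \<le> f R'" for R R'
    using N[OF that(1)] N[OF that(2)] that(3) by (simp add: F_def)
  have F_double: "F (2 * R) \<le> 2 * F R" if "N \<le> R" for R
  proof -
    have "f (2 * R) > 0" using that N1 by (intro conjunct1[OF conjunct2[OF N]]) linarith
    hence "F (2 * R) \<le> log 2 ((f R)\<^sup>2)" using N[OF that] by (simp add: F_def)
    thus ?thesis using N[OF that] by (simp add: F_def log_nat_power)
  qed
  have F_eta: "2 * F R \<le> F (eta_plus * R)" if "N \<le> R" for R
  proof -
    have "1 * N \<le> eta_plus * R" using that N1 eta_bounds by (intro mult_mono) auto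
    hence "log 2 ((f R)\<^sup>2) \<le> F (eta_plus * R)" using N[OF that] N[of "eta_plus * R"] by (simp add: F_def)
    thus ?thesis using N[OF that] by (simp add: F_def log_nat_power)
  qed
  have F_coarse: "F R \<le> F (C * S)" if "N \<le> R" "R \<le> S" for R S
  proof (rule F_mono[OF that(1)])
    have "1 * N \<le> C * S" using that N1 C by (intro mult_mono) auto
    thus "N \<le> C * S" by simp
    have "C0 * S \<le> C * S" using C that N1 by (intro mult_right_mono) auto
    hence "R \<le> C / C0 * S" using that(2) C0(1) by (simp add: field_simps) (meson order_trans mult_left_mono less_imp_le)
    hence "f R \<le> f (C0 * (C / C0 * S))" using N[OF that(1)] by blast
    thus "f R \<le> f (C * S)" using C0(1) by simp
  qed
  \<comment> \<open>From any \<open>R'\<close>, doubling reaches arguments beyond \<open>C * R\<close>, where \<open>F\<close> is at least \<open>F R\<close>.\<close>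
  have far: "\<exists>n. F R \<le> 2 ^ n * F R' \<and> 1 < n" if "N \<le> R" "N \<le> R'" for R R'
  proof -
    obtain n where n: "max 4 (C * R) < 2 ^ n" using real_arch_pow[of 2 "max 4 (C * R)"] by auto
    have "1 < n"
    proof (rule ccontr)
      assume "\<not> 1 < n"
      hence "(2 :: real) ^ n \<le> 2 ^ 1" by (intro power_increasing) auto
      thus False using n by simp
    qed
    have "C * R \<le> 2 ^ n * 1" using n by simp
    also have "\<dots> \<le> 2 ^ n * R'" using that(2) N1 by (intro mult_left_mono) auto
    finally have "R \<le> 2 ^ n * R' / C" using C by (simp add: field_simps)
    from F_coarse[OF that(1) this] have "F R \<le> F (2 ^ n * R')" using C by simp
    also have "\<dots> \<le> 2 ^ n * F R'"
      by (rule unroll_doubling[of N F, OF _ F_double that(2)]) (use N1 in auto)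
    finally show ?thesis using \<open>1 < n\<close> by blast
  qed
  \<comment> \<open>A negative value would decrease without bound under doubling, against coarse monotonicity.\<close>
  have F_nonneg: "0 \<le> F R" if NR: "N \<le> R" for R
  proof (rule ccontr)
    assume neg: "\<not> 0 \<le> F R"
    obtain n where n: "F R \<le> 2 ^ n * F R" "1 < n" using far[OF NR NR] by blast
    have "(1 :: real) < 2 ^ n" using n(2) by (intro one_less_power) auto
    hence "2 ^ n * F R < 1 * F R" using neg by (intro mult_strict_right_mono_neg) auto
    thus False using n(1) by simp
  qed
  show ?thesis
  proof (cases "\<exists>R\<ge>N. F R = 0")
    case True
    then obtain R' where R': "N \<le> R'" "F R' = 0" by blast
    have f_1: "f R = 1" if "N \<le> R" for R
      using far[OF that R'(1)] F_nonneg[OF that] R'(2) f_F[OF that] by auto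
    obtain G :: "nat monoid" and S where G: "group G" "finite S" "semigroup_generates G S"
      "\<And>R. 0 \<le> R \<Longrightarrow> growth G S R = 1"
      using ex_trivial_group by blast
    have "growth G S R \<le> f (1 * R) \<and> f R \<le> growth G S (1 * R)" if "N \<le> R" for R
      using f_1[OF that] G(4)[of R] that N1 by simp
    hence "growth G S \<sim>\<^sub>g f" unfolding growth_equiv_def eventually_at_top_linorder
      by (intro exI[of _ 1]) auto
    thus ?thesis using G by blast
  next
    case False
    \<comment> \<open>The normalization makes \<open>H 3 = 1\<close>, and 3 is the mass of the initial weight.\<close>
    define E where "E = F (N * 3)"
    define H where "H R = F (N * R) / E" for R
    have N_mult: "N \<le> N * R" if "1 \<le> R" for R
      using mult_left_mono[OF that, of N] N1 by simp
    have E: "0 < E" using False F_nonneg[of "N * 3"] N_mult[of 3]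
      unfolding E_def by (metis less_eq_real_def numeral_le_iff one_le_numeral)
    interpret coarse_scale H C
    proof
      fix R :: real assume R: "1 \<le> R"
      show "H (2 * R) \<le> 2 * H R" using F_double[OF N_mult[OF R]] E
        by (simp add: H_def divide_right_mono mult.left_commute)
      show "2 * H R \<le> H (eta_plus * R)" using F_eta[OF N_mult[OF R]] E
        by (simp add: H_def divide_right_mono mult.left_commute)
      show "H R \<le> H (C * S)" if "R \<le> S" for S
      proof -
        have "N * R \<le> N * S" using that N1 by simp
        from F_coarse[OF N_mult[OF R] this] show ?thesis using E
          by (simp add: H_def divide_right_mono mult.left_commute)
      qed
    next
      show "H 3 = 1" using E by (simp add: H_def E_def)
    qed (rule C(1))
    obtain m where m: "\<And>j. H (s j) \<le> 2 ^ m * 8 ^ j" using H_weight_seq_le by blast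
    obtain G :: "nat monoid" and S where G: "group G" "finite S" "semigroup_generates G S"
      and upper: "\<And>j R. R \<le> s j \<Longrightarrow> growth G S R \<le> 11 ^ (47 * 8 ^ j)"
      and lower: "\<And>j R. 2 * s j \<le> R \<Longrightarrow> 2 ^ (8 ^ j) \<le> growth G S R"
      using growth_of_weight_seq[of H] by blast
    obtain p where p: "1504 / E < 2 ^ p" using real_arch_pow[of 2 "1504 / E"] by auto
    obtain q where q: "C < 2 ^ q" using real_arch_pow[of 2 C] by auto
    obtain r where r: "2 ^ q * E * 2 ^ m < 8 ^ r" using real_arch_pow[of 8 "2 ^ q * E * 2 ^ m"] by auto
    \<comment> \<open>The two entries serve the two inequalities between the growth and \<open>f\<close>.\<close>
    define K where "K = max (eta_plus ^ p * N * 81 * C) (2 * 27 ^ (r + 1))"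
    have K: "eta_plus ^ p * N * 81 * C \<le> K" "2 * 27 ^ (r + 1) \<le> K" by (auto simp: K_def)
    have K0: "0 < K" using K(2) zero_less_power[of "27::real" "r + 1"] by linarith
    have main: "growth G S R \<le> f (C * K * R) \<and> f R \<le> growth G S (C * K * R)"
      if R: "max N 3 \<le> R" for R
    proof -
      obtain n where "R < 8 ^ n" using real_arch_pow[of 8 R] by auto
      hence ex: "R < s n" using mass_weight_seq_ge[of n H] by linarith
      \<comment> \<open>The scale just above \<open>R\<close>; the one below it is smaller by a factor at most 27.\<close>
      define j where "j = (LEAST j. R < s j)"
      have j: "R < s j" unfolding j_def by (rule LeastI[of "\<lambda>j. R < s j", OF ex])
      have "j \<noteq> 0" using j R s_0 by (metis max.bounded_iff not_less)
      then obtain i where i: "j = Suc i" by (cases j) auto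
      have si: "s i \<le> R"
        using not_less_Least[of i "\<lambda>j. R < s j"] i unfolding j_def by auto
      have "growth G S R \<le> 11 ^ (47 * 8 ^ j)" using upper j by simp
      also have "\<dots> \<le> (2 ^ 4) ^ (47 * 8 ^ j)" by (intro power_mono) auto
      also have "\<dots> = 2 ^ (1504 * 8 ^ i)" unfolding power_mult[symmetric] by (simp add: i)
      also have "\<dots> = 2 powr real (1504 * 8 ^ i)" by (rule powr_realpow[symmetric]) simp
      also have "\<dots> = 2 powr (1504 * 8 ^ i)" by simp
      also have "\<dots> \<le> 2 powr F (C * K * R)"
      proof (rule powr_mono)
        let ?x = "N * (81 * C * s i)"
        have x1: "1 \<le> 81 * C * s i"
          using mult_mono[of 1 "81 * C" 1 "s i"] C s_ge_1[of i] by simp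
        have x: "N \<le> ?x" using x1 by (rule N_mult)
        have "1504 * 8 ^ i \<le> 1504 * H (81 * C * s i)" using H_weight_seq_ge[of i] by simp
        also have "\<dots> = 1504 / E * F ?x" by (simp add: H_def)
        also have "\<dots> \<le> 2 ^ p * F ?x" using p F_nonneg[OF x] by (intro mult_right_mono) auto
        also have "\<dots> \<le> F (eta_plus ^ p * ?x)"
          by (rule unroll_eta[of N F, OF _ F_eta x]) (use N1 in auto)
        also have "\<dots> \<le> F (C * (K * R))"
        proof (rule F_coarse)
          have "1 * N \<le> eta_plus ^ p * ?x"
            using x N1 eta_bounds by (intro mult_mono one_le_power) auto
          thus "N \<le> eta_plus ^ p * ?x" by simp
          have "eta_plus ^ p * N * 81 * C * s i \<le> K * R"
            using K(1) K0 si s_ge_1[of i] by (intro mult_mono) auto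
          thus "eta_plus ^ p * ?x \<le> K * R" by (simp add: mult_ac)
        qed
        finally show "1504 * 8 ^ i \<le> F (C * K * R)" by (simp add: mult_ac)
      qed simp
      also have "\<dots> = f (C * K * R)"
      proof (rule f_F[symmetric])
        have "2 * 1 \<le> 2 * (27::real) ^ (r + 1)" by (intro mult_left_mono one_le_power) auto
        hence "1 \<le> K" using K(2) by linarith
        hence "1 * 1 \<le> C * K" using C by (intro mult_mono) auto
        hence "1 * N \<le> C * K * R" using R N1 by (intro mult_mono) auto
        thus "N \<le> C * K * R" by simp
      qed
      finally have 1: "growth G S R \<le> f (C * K * R)" .
      have "f R = 2 powr F R" using f_F R by simp
      also have "\<dots> \<le> 2 powr (8 ^ (j + r))"
      proof (rule powr_mono)
        have x: "N \<le> N * s j" using s_ge_1[of j] by (rule N_mult)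
        have "R \<le> s j" using j by simp
        also have "\<dots> \<le> N * s j" using mult_right_mono[of 1 N "s j"] N1 s_ge_1[of j] by simp
        also have "\<dots> \<le> 2 ^ q / C * (N * s j)"
          using mult_right_mono[of 1 "2 ^ q / C" "N * s j"] q C x N1 by (simp add: field_simps)
        finally have "F R \<le> F (C * (2 ^ q / C * (N * s j)))" using R by (intro F_coarse) auto
        also have "\<dots> = F (2 ^ q * (N * s j))" using C by simp
        also have "\<dots> \<le> 2 ^ q * F (N * s j)"
          by (rule unroll_doubling[of N F, OF _ F_double x]) (use N1 in auto)
        also have "\<dots> = 2 ^ q * E * H (s j)" using E by (simp add: H_def)
        also have "\<dots> \<le> 2 ^ q * E * (2 ^ m * 8 ^ j)" using m E by (intro mult_left_mono) auto
        also have "\<dots> = 2 ^ q * E * 2 ^ m * 8 ^ j" by simp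
        also have "\<dots> \<le> 8 ^ r * 8 ^ j" using r by (intro mult_right_mono) auto
        finally show "F R \<le> 8 ^ (j + r)" by (simp add: power_add mult.commute)
      qed simp
      also have "\<dots> = 2 powr real (8 ^ (j + r))" by simp
      also have "\<dots> = 2 ^ (8 ^ (j + r))" by (rule powr_realpow) simp
      also have "\<dots> \<le> growth G S (C * K * R)"
      proof (rule lower)
        have "s (i + n) \<le> 27 ^ n * s i" for n
        proof (induction n)
          case (Suc n)
          have "s (i + Suc n) \<le> 27 * s (i + n)"
            using mass_weight_seq_Suc(2)[of H "i + n"] by (simp only: add_Suc_right)
          thus ?case using Suc by (simp del: weight_seq.simps)
        qed simp
        from this[of "r + 1"] have "2 * s (j + r) \<le> 2 * 27 ^ (r + 1) * s i"
          by (simp add: i add.commute mult_ac del: weight_seq.simps)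
        also have "\<dots> \<le> K * R" using K K0 si s_ge_1[of i] by (intro mult_mono) auto
        also have "\<dots> \<le> C * (K * R)"
          using mult_right_mono[of 1 C "K * R"] C K0 R N1 by simp
        finally show "2 * s (j + r) \<le> C * K * R" by (simp add: mult_ac)
      qed
      finally show ?thesis using 1 by blast
    qed
    have "growth G S \<sim>\<^sub>g f" unfolding growth_equiv_def eventually_at_top_linorder
      using main C K0 by (intro exI[of _ "C * K"] conjI exI[of _ "max N 3"]) auto
    thus ?thesis using G by blast
  qed
qed

end
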